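(* Let $1 \leq p < \infty$ and let $f \in L^p(\mathbb{R})$. Let $k \geq 0$ be an integer, $0<\alpha<1$, and $x_0 \in \mathbb{R}$. If $f$ is $C^{k,\alpha}$ in a neighborhood of $x_0$, then its Hilbert transform $Hf$ is $C^{k,\alpha_0}$ in a neighborhood of $x_0$ for any $0<\alpha_0<\alpha$.
   Context: For $f \in L^p(\mathbb{R})$, $1 \leq p<\infty$, the Hilbert transform of $f$ is defined (for a.e. $x$) as the principal value $$Hf(x) = p.v.\,\frac{1}{\pi}\int_{-\infty}^{\infty}\frac{f(t)}{x-t}\,dt := \lim_{\epsilon\to 0}\frac{1}{\pi}\int_{|x-t|>\epsilon}\frac{f(t)}{x-t}\,dt.$$ $C^{0,\alpha}$ denotes functions that are H\"older continuous with exponent $\alpha$ on a bounded interval, and $C^{k,\alpha}$ denotes functions that are $k$ times continuously differentiable and whose $k$-th derivative is H\"older continuous with exponent $\alpha$. *)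

theory Defs
  imports "HOL-Analysis.Analysis"
begin

text \<open>
  Functions take values in a type of class \<open>{real_normed_field, euclidean_space}\<close>, which has the
  instances \<open>real\<close> and \<open>complex\<close>: the real-valued and the complex-valued case are treated together.
\<close>

definition in_Lp :: "real \<Rightarrow> (real \<Rightarrow> 'a::{real_normed_field,euclidean_space}) \<Rightarrow> bool" where
  "in_Lp p f \<longleftrightarrow> f \<in> borel_measurable lebesgue \<and> integrable lebesgue (\<lambda>t. norm (f t) powr p)"

definition truncated_hilbert ::
    "(real \<Rightarrow> 'a::{real_normed_field,euclidean_space}) \<Rightarrow> real \<Rightarrow> real \<Rightarrow> 'a" where
  "truncated_hilbert f x \<epsilon> =
     of_real (1 / pi) * (LINT t:{t. \<bar>x - t\<bar> > \<epsilon>}|lebesgue. f t / of_real (x - t))"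

definition hilbert_exists_at ::
    "(real \<Rightarrow> 'a::{real_normed_field,euclidean_space}) \<Rightarrow> real \<Rightarrow> bool" where
  "hilbert_exists_at f x \<longleftrightarrow> (\<exists>L. (truncated_hilbert f x \<longlongrightarrow> L) (at_right 0))"

text \<open>The value is meaningful only at points where \<^const>\<open>hilbert_exists_at\<close> holds.\<close>

definition hilbert_transform ::
    "(real \<Rightarrow> 'a::{real_normed_field,euclidean_space}) \<Rightarrow> real \<Rightarrow> 'a" where
  "hilbert_transform f x = Lim (at_right 0) (truncated_hilbert f x)"

definition holder_continuous_on ::
    "real \<Rightarrow> real set \<Rightarrow> (real \<Rightarrow> 'a::real_normed_vector) \<Rightarrow> bool" where
  "holder_continuous_on \<alpha> S f \<longleftrightarrow>
     (\<exists>C. \<forall>x\<in>S. \<forall>y\<in>S. norm (f x - f y) \<le> C * \<bar>x - y\<bar> powr \<alpha>)"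

definition nth_derivative ::
    "nat \<Rightarrow> (real \<Rightarrow> 'a::real_normed_vector) \<Rightarrow> real \<Rightarrow> 'a" where
  "nth_derivative n f = ((\<lambda>g x. vector_derivative g (at x)) ^^ n) f"

text \<open>
  Two-sided derivatives are used, so the following is intended for open \<open>S\<close>.
\<close>

definition k_times_cont_diff_on ::
    "nat \<Rightarrow> real set \<Rightarrow> (real \<Rightarrow> 'a::real_normed_vector) \<Rightarrow> bool" where
  "k_times_cont_diff_on k S f \<longleftrightarrow>
     (\<forall>j<k. \<forall>x\<in>S. nth_derivative j f differentiable (at x)) \<and>
     (\<forall>j\<le>k. continuous_on S (nth_derivative j f))"

definition Ck_holder_on ::
    "nat \<Rightarrow> real \<Rightarrow> real set \<Rightarrow> (real \<Rightarrow> 'a::real_normed_vector) \<Rightarrow> bool" where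
  "Ck_holder_on k \<alpha> S f \<longleftrightarrow>
     k_times_cont_diff_on k S f \<and> holder_continuous_on \<alpha> S (nth_derivative k f)"

definition Ck_holder_near ::
    "nat \<Rightarrow> real \<Rightarrow> real \<Rightarrow> (real \<Rightarrow> 'a::real_normed_vector) \<Rightarrow> bool" where
  "Ck_holder_near k \<alpha> x0 f \<longleftrightarrow> (\<exists>a b. a < x0 \<and> x0 < b \<and> Ck_holder_on k \<alpha> {a<..<b} f)"

end

theory Submission
  imports Defs
begin

text \<open>
  Split the kernel as \<open>1 / u = K u + E u\<close>, where \<open>K\<close> is odd, of class \<open>C\<^sup>k\<^sup>+\<^sup>1\<close>, with derivatives of
  size \<open>O(1 / (1 + \<bar>u\<bar>))\<close>, and equal to \<open>1 / u\<close> for \<open>\<bar>u\<bar> \<ge> \<delta>\<close>. Then \<open>pi * H f x\<close> is the sum of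
  \<open>\<integral> K (x - t) * f t dt\<close>, where all derivatives fall on \<open>K\<close>, and of
  \<open>1/2 * \<integral> E u * (f (x - u) - f (x + u)) du\<close>, an integral over the fixed interval \<open>\<bar>u\<bar> < \<delta>\<close>, where
  all derivatives fall on \<open>f\<close> and no boundary terms appear. For \<open>g\<close> Hoelder continuous of exponent
  \<open>\<alpha>\<close> the difference \<open>g (x - u) - g (x + u)\<close> is \<open>O(\<bar>u\<bar> powr \<alpha>)\<close>, while replacing \<open>x\<close> by \<open>y\<close> changes
  it by \<open>O(\<bar>x - y\<bar> powr \<alpha>)\<close>; interpolating between the two bounds yields
  \<open>O(\<bar>x - y\<bar> powr \<alpha>\<^sub>0 * \<bar>u\<bar> powr (\<alpha> - \<alpha>\<^sub>0))\<close>, which remains integrable against \<open>1 / \<bar>u\<bar>\<close> exactly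
  because \<open>\<alpha>\<^sub>0 < \<alpha>\<close>.
\<close>

section \<open>Parameter integrals with Hoelder continuous integrand\<close>

text \<open>The derivatives are carried as an explicit family instead of iterated
  \<open>vector_derivative\<close>, so sums, multiples and parameter integrals can be treated order
  by order. Continuity at the orders below \<open>k\<close> is implicit in
  differentiability.\<close>

definition derivative_chain ::
    "nat \<Rightarrow> real \<Rightarrow> real set \<Rightarrow> (nat \<Rightarrow> real \<Rightarrow> 'a::real_normed_vector) \<Rightarrow> bool" where
  "derivative_chain k \<beta> S \<Phi> \<longleftrightarrow>
     (\<forall>j<k. \<forall>x\<in>S. (\<Phi> j has_vector_derivative \<Phi> (Suc j) x) (at x)) \<and>
     holder_continuous_on \<beta> S (\<Phi> k)"

lemma holder_continuous_on_imp_continuous_on: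
  assumes "holder_continuous_on \<beta> S f" "0 < \<beta>"
  shows "continuous_on S f"
proof -
  obtain C where C: "\<And>x y. x \<in> S \<Longrightarrow> y \<in> S \<Longrightarrow> norm (f x - f y) \<le> C * \<bar>x - y\<bar> powr \<beta>"
    using assms unfolding holder_continuous_on_def by blast
  have "(f \<longlongrightarrow> f x) (at x within S)" if "x \<in> S" for x
  proof (rule Lim_null[THEN iffD2], rule Lim_null_comparison)
    show "\<forall>\<^sub>F y in at x within S. norm (f y - f x) \<le> C * \<bar>y - x\<bar> powr \<beta>"
      using C that by (auto simp: eventually_at_filter)
    have "((\<lambda>y. \<bar>y - x\<bar>) \<longlongrightarrow> 0) (at x within S)"
      by (auto intro!: tendsto_eq_intros)
    then have "((\<lambda>y. \<bar>y - x\<bar> powr \<beta>) \<longlongrightarrow> 0) (at x within S)"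
      using tendsto_zero_powrI[OF _ tendsto_const, of "\<lambda>y. \<bar>y - x\<bar>" "at x within S" \<beta>] assms(2)
      by auto
    then show "((\<lambda>y. C * \<bar>y - x\<bar> powr \<beta>) \<longlongrightarrow> 0) (at x within S)"
      by (auto intro: tendsto_mult_right_zero)
  qed
  then show ?thesis by (simp add: continuous_on_def)
qed

lemma holder_continuous_on_cong:
  assumes "\<And>x. x \<in> S \<Longrightarrow> f x = g x"
  shows "holder_continuous_on \<beta> S f \<longleftrightarrow> holder_continuous_on \<beta> S g"
  using assms by (simp add: holder_continuous_on_def)

text \<open>A two-sided derivative at a point of the open set \<open>S\<close> depends only on
  values inside \<open>S\<close>. Agreement of \<open>g\<close> with \<open>\<Phi> 0\<close> on
  \<open>S\<close> therefore propagates by induction to \<open>nth_derivative j g\<close> and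
  \<open>\<Phi> j\<close> for all \<open>j \<le> k\<close>.\<close>

lemma derivative_chain_imp_Ck_holder_on:
  assumes "derivative_chain k \<beta> S \<Phi>" "open S" "0 < \<beta>" and g: "\<And>x. x \<in> S \<Longrightarrow> g x = \<Phi> 0 x"
  shows "Ck_holder_on k \<beta> S g"
proof -
  have der: "(\<Phi> j has_vector_derivative \<Phi> (Suc j) x) (at x)" if "j < k" "x \<in> S" for j x
    using assms(1) that by (auto simp: derivative_chain_def)
  have eq: "\<forall>x\<in>S. nth_derivative j g x = \<Phi> j x" if "j \<le> k" for j
    using that
  proof (induction j)
    case 0
    then show ?case using g by (simp add: nth_derivative_def)
  next
    case (Suc j)
    show ?case
    proof
      fix x assume "x \<in> S"
      then have "(nth_derivative j g has_vector_derivative \<Phi> (Suc j) x) (at x)"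
        using has_vector_derivative_transform_within_open[OF der, of j x S "nth_derivative j g"]
          Suc assms(2) by auto
      then show "nth_derivative (Suc j) g x = \<Phi> (Suc j) x"
        by (auto simp: nth_derivative_def dest: vector_derivative_at)
    qed
  qed
  have der': "(nth_derivative j g has_vector_derivative \<Phi> (Suc j) x) (at x)"
    if "j < k" "x \<in> S" for j x
    using has_vector_derivative_transform_within_open[OF der, of j x S "nth_derivative j g"]
      that eq[of j] assms(2) by auto
  have hol: "holder_continuous_on \<beta> S (nth_derivative k g)"
    using assms(1) holder_continuous_on_cong[of S "nth_derivative k g" "\<Phi> k" \<beta>] eq[of k]
    by (auto simp: derivative_chain_def)
  have "continuous_on S (nth_derivative j g)" if "j \<le> k" for j
  proof (cases "j = k")
    case True
    then show ?thesis using holder_continuous_on_imp_continuous_on[OF hol assms(3)] by simp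
  next
    case False
    then show ?thesis using der' that
      by (meson continuous_at_imp_continuous_on has_vector_derivative_continuous le_neq_implies_less)
  qed
  moreover have "nth_derivative j g differentiable (at x)" if "j < k" "x \<in> S" for j x
    using der'[OF that] by (rule differentiableI_vector)
  ultimately show ?thesis
    using hol by (auto simp: Ck_holder_on_def k_times_cont_diff_on_def)
qed

lemma derivative_chain_add:
  assumes "derivative_chain k \<beta> S \<Phi>" "derivative_chain k \<beta> S \<Psi>"
  shows "derivative_chain k \<beta> S (\<lambda>j x. \<Phi> j x + \<Psi> j x)"
proof -
  obtain C D where
    C: "\<And>x y. x \<in> S \<Longrightarrow> y \<in> S \<Longrightarrow> norm (\<Phi> k x - \<Phi> k y) \<le> C * \<bar>x - y\<bar> powr \<beta>" and
    D: "\<And>x y. x \<in> S \<Longrightarrow> y \<in> S \<Longrightarrow> norm (\<Psi> k x - \<Psi> k y) \<le> D * \<bar>x - y\<bar> powr \<beta>"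
    using assms unfolding derivative_chain_def holder_continuous_on_def by meson
  have "norm (\<Phi> k x + \<Psi> k x - (\<Phi> k y + \<Psi> k y)) \<le> (C + D) * \<bar>x - y\<bar> powr \<beta>"
    if "x \<in> S" "y \<in> S" for x y
    using norm_triangle_ineq[of "\<Phi> k x - \<Phi> k y" "\<Psi> k x - \<Psi> k y"] C[OF that] D[OF that]
    by (simp add: algebra_simps)
  then show ?thesis
    using assms unfolding derivative_chain_def holder_continuous_on_def
    by (auto intro!: has_vector_derivative_add)
qed

lemma derivative_chain_scaleR:
  assumes "derivative_chain k \<beta> S \<Phi>"
  shows "derivative_chain k \<beta> S (\<lambda>j x. c *\<^sub>R \<Phi> j x)"
proof -
  obtain C where
    C: "\<And>x y. x \<in> S \<Longrightarrow> y \<in> S \<Longrightarrow> norm (\<Phi> k x - \<Phi> k y) \<le> C * \<bar>x - y\<bar> powr \<beta>"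
    using assms unfolding derivative_chain_def holder_continuous_on_def by meson
  have "norm (c *\<^sub>R \<Phi> k x - c *\<^sub>R \<Phi> k y) \<le> (\<bar>c\<bar> * C) * \<bar>x - y\<bar> powr \<beta>"
    if "x \<in> S" "y \<in> S" for x y
    using mult_left_mono[OF C[OF that], of "\<bar>c\<bar>"]
    by (simp flip: scaleR_diff_right add: mult.assoc)
  moreover have "((\<lambda>x. c *\<^sub>R \<Phi> j x) has_vector_derivative c *\<^sub>R \<Phi> (Suc j) x) (at x)"
    if "j < k" "x \<in> S" for j x
    using assms that has_vector_derivative_scaleR[OF DERIV_const[of c] , of "\<Phi> j" "\<Phi> (Suc j) x" x UNIV]
    by (auto simp: derivative_chain_def)
  ultimately show ?thesis
    unfolding derivative_chain_def holder_continuous_on_def by blast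
qed

text \<open>A Hoelder modulus of the integrand that is integrable in the parameter replaces dominated
  convergence: by the mean value inequality the remainder of the first-order expansion is
  \<open>O(\<bar>y - x\<bar> powr (1 + \<beta>))\<close>.\<close>
lemma derivative_chain_integral:
  fixes \<phi> :: "nat \<Rightarrow> real \<Rightarrow> 'b::euclidean_space \<Rightarrow> 'a::euclidean_space"
  assumes S: "open S" "convex S" and \<beta>: "0 < \<beta>"
    and int: "\<And>j x. j \<le> k \<Longrightarrow> x \<in> S \<Longrightarrow> integrable M (\<phi> j x)"
    and der: "\<And>j x t. j < k \<Longrightarrow> x \<in> S \<Longrightarrow>
      ((\<lambda>x. \<phi> j x t) has_vector_derivative \<phi> (Suc j) x t) (at x)"
    and hol: "\<And>j x y t. j \<le> k \<Longrightarrow> x \<in> S \<Longrightarrow> y \<in> S \<Longrightarrow>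
      norm (\<phi> j x t - \<phi> j y t) \<le> \<bar>x - y\<bar> powr \<beta> * w j t"
    and w: "\<And>j. j \<le> k \<Longrightarrow> integrable M (w j)"
  shows "derivative_chain k \<beta> S (\<lambda>j x. \<integral>t. \<phi> j x t \<partial>M)"
proof -
  have hol': "norm ((\<integral>t. \<phi> k x t \<partial>M) - (\<integral>t. \<phi> k y t \<partial>M)) \<le> (\<integral>t. w k t \<partial>M) * \<bar>x - y\<bar> powr \<beta>"
    if "x \<in> S" "y \<in> S" for x y
  proof -
    have "norm (\<integral>t. \<phi> k x t - \<phi> k y t \<partial>M) \<le> (\<integral>t. \<bar>x - y\<bar> powr \<beta> * w k t \<partial>M)"
      using that int hol w
      by (intro Bochner_Integration.integral_norm_bound_integral Bochner_Integration.integrable_diff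
          integrable_mult_right) auto
    then show ?thesis using that int by (simp add: mult.commute)
  qed
  have der': "((\<lambda>x. \<integral>t. \<phi> j x t \<partial>M) has_vector_derivative (\<integral>t. \<phi> (Suc j) x t \<partial>M)) (at x)"
    if j: "j < k" and x: "x \<in> S" for j x
  proof -
    let ?G = "\<lambda>y. (\<integral>t. \<phi> j y t \<partial>M)" and ?G' = "\<integral>t. \<phi> (Suc j) x t \<partial>M"
    let ?B = "\<integral>t. w (Suc j) t \<partial>M"
    have bd: "norm (?G y - ?G x - (y - x) *\<^sub>R ?G') \<le> \<bar>y - x\<bar> * (\<bar>y - x\<bar> powr \<beta> * ?B)"
      if y: "y \<in> S" for y
    proof -
      have pt: "norm (\<phi> j y t - \<phi> j x t - (y - x) *\<^sub>R \<phi> (Suc j) x t)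
          \<le> \<bar>y - x\<bar> * (\<bar>y - x\<bar> powr \<beta> * w (Suc j) t)" for t
      proof -
        have sub: "closed_segment x y \<subseteq> S"
          using S(2) x y by (simp add: convex_contains_segment)
        have "norm (\<phi> j y t - \<phi> j x t - (y - x) *\<^sub>R \<phi> (Suc j) x t)
          \<le> norm (y - x) * (\<bar>y - x\<bar> powr \<beta> * w (Suc j) t)"
        proof (rule vector_differentiable_bound_linearization[where S = "closed_segment x y"])
          fix z assume z: "z \<in> closed_segment x y"
          then show "((\<lambda>x. \<phi> j x t) has_vector_derivative \<phi> (Suc j) z t) (at z within closed_segment x y)"
            using der[OF j, of z t] sub by (auto intro: has_vector_derivative_at_within)
          have h: "norm (\<phi> (Suc j) z t - \<phi> (Suc j) x t) \<le> \<bar>z - x\<bar> powr \<beta> * w (Suc j) t"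
            using hol[of "Suc j" z x t] j x z sub by auto
          \<comment> \<open>The sign of \<open>w\<close> is read off from \<open>hol\<close> at two
            distinct points, where the factor \<open>\<bar>y - x\<bar> powr \<beta>\<close> is
            positive. It is what allows \<open>\<bar>z - x\<bar>\<close> to be enlarged to
            \<open>\<bar>y - x\<bar>\<close>.\<close>
          have w0: "0 \<le> w (Suc j) t" if "y \<noteq> x"
            using norm_ge_zero[THEN order_trans, OF hol[of "Suc j" y x t]] j x y that
            by (auto simp: zero_le_mult_iff)
          show "norm (\<phi> (Suc j) z t - \<phi> (Suc j) x t) \<le> \<bar>y - x\<bar> powr \<beta> * w (Suc j) t"
          proof (cases "y = x")
            case True
            then show ?thesis using h z by simp
          next
            case False
            have "\<bar>z - x\<bar> powr \<beta> * w (Suc j) t \<le> \<bar>y - x\<bar> powr \<beta> * w (Suc j) t"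
              using w0[OF False] z \<beta> by (intro mult_right_mono powr_mono2)
                (auto simp: closed_segment_eq_real_ivl split: if_splits)
            then show ?thesis using h by linarith
          qed
        qed auto
        then show ?thesis by simp
      qed
      have i: "integrable M (\<phi> j y)" "integrable M (\<phi> j x)" "integrable M (\<phi> (Suc j) x)"
        using int[of j] int[of "Suc j"] x y j by auto
      have "norm (\<integral>t. \<phi> j y t - \<phi> j x t - (y - x) *\<^sub>R \<phi> (Suc j) x t \<partial>M)
          \<le> (\<integral>t. \<bar>y - x\<bar> * (\<bar>y - x\<bar> powr \<beta> * w (Suc j) t) \<partial>M)"
        using i w[of "Suc j"] j pt
        by (intro Bochner_Integration.integral_norm_bound_integral Bochner_Integration.integrable_diff
          integrable_mult_right integrable_scaleR_right) auto
      then show ?thesis using i by simp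
    qed
    obtain e where e: "e > 0" "\<And>y. \<bar>y - x\<bar> < e \<Longrightarrow> y \<in> S"
      using S(1) x by (auto simp: open_dist dist_real_def)
    have "((\<lambda>y. (?G y - ?G x - (y - x) *\<^sub>R ?G') /\<^sub>R norm (y - x)) \<longlongrightarrow> 0) (at x)"
    proof (rule Lim_null_comparison)
      show "\<forall>\<^sub>F y in at x. norm ((?G y - ?G x - (y - x) *\<^sub>R ?G') /\<^sub>R norm (y - x))
          \<le> \<bar>y - x\<bar> powr \<beta> * ?B"
        unfolding eventually_at
      proof (intro exI[of _ e] conjI ballI impI e(1))
        fix y assume y: "y \<noteq> x \<and> dist y x < e"
        then have pos: "\<bar>y - x\<bar> > 0" by simp
        have "norm (?G y - ?G x - (y - x) *\<^sub>R ?G') \<le> \<bar>y - x\<bar> * (\<bar>y - x\<bar> powr \<beta> * ?B)"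
          using bd e(2) y by (simp add: dist_real_def)
        then have "norm (?G y - ?G x - (y - x) *\<^sub>R ?G') / \<bar>y - x\<bar> \<le> \<bar>y - x\<bar> powr \<beta> * ?B"
          using pos by (simp add: divide_le_eq mult.commute)
        then show "norm ((?G y - ?G x - (y - x) *\<^sub>R ?G') /\<^sub>R norm (y - x)) \<le> \<bar>y - x\<bar> powr \<beta> * ?B"
          by (simp add: divide_inverse mult.commute)
      qed
      have "((\<lambda>y. \<bar>y - x\<bar>) \<longlongrightarrow> 0) (at x)"
        by (auto intro!: tendsto_eq_intros)
      then have "((\<lambda>y. \<bar>y - x\<bar> powr \<beta>) \<longlongrightarrow> 0) (at x)"
        using tendsto_zero_powrI[OF _ tendsto_const, of "\<lambda>y. \<bar>y - x\<bar>" "at x" \<beta>] \<beta> by auto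
      then show "((\<lambda>y. \<bar>y - x\<bar> powr \<beta> * ?B) \<longlongrightarrow> 0) (at x)"
        by (rule tendsto_mult_left_zero)
    qed
    then show ?thesis
      unfolding has_vector_derivative_def has_derivative_at2
      by (auto simp: bounded_linear_scaleR_left inverse_eq_divide diff_diff_eq)
  qed
  show ?thesis
    unfolding derivative_chain_def holder_continuous_on_def using hol' der' by blast
qed

section \<open>A smooth truncation of the kernel \<open>1 / u\<close>\<close>

text \<open>The decay is the borderline one of \<open>1 / u\<close> itself, and it is imposed
  uniformly on all orders: it matches the weight against which a function in \<open>L^p\<close> is
  integrable, so every derivative of the kernel may be convolved with \<open>f\<close>.\<close>

definition decaying_kernel :: "nat \<Rightarrow> (nat \<Rightarrow> real \<Rightarrow> real) \<Rightarrow> bool" where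
  "decaying_kernel n \<kappa> \<longleftrightarrow>
     (\<forall>j<n. \<forall>u. (\<kappa> j has_real_derivative \<kappa> (Suc j) u) (at u)) \<and>
     (\<forall>j\<le>n. continuous_on UNIV (\<kappa> j)) \<and>
     (\<exists>C. \<forall>j\<le>n. \<forall>u. \<bar>\<kappa> j u\<bar> \<le> C / (1 + \<bar>u\<bar>))"

text \<open>The sum is the Taylor polynomial of degree \<open>n\<close> of \<open>1 / v ^ (j + 1)\<close> at \<open>v = 1\<close>, so the two
  pieces fit together in a function of class \<open>C\<^sup>n\<close>.\<close>
definition inverse_power_jet :: "nat \<Rightarrow> nat \<Rightarrow> real \<Rightarrow> real" where
  "inverse_power_jet n j v =
     (if v \<le> 1 then (\<Sum>i\<le>n. real ((i + j) choose j) * (1 - v) ^ i) else 1 / v ^ (j + 1))"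

lemma sum_atMost_zero_power: "(\<Sum>i\<le>n. f i * (0::real) ^ i) = f 0"
  by (induction n) auto

text \<open>The family of jets is closed under differentiation up to the factor
  \<open>- (j + 1)\<close>: the degree of the Taylor polynomial drops by one while the exponent of
  the inverse power rises by one.\<close>

lemma has_real_derivative_inverse_power_jet:
  "(inverse_power_jet (Suc n) j has_real_derivative
     - (real j + 1) * inverse_power_jet n (Suc j) v) (at v)"
proof -
  let ?P = "\<lambda>v::real. \<Sum>i\<le>Suc n. real ((i + j) choose j) * (1 - v) ^ i"
  let ?P' = "\<lambda>v::real. - (real j + 1) * (\<Sum>i\<le>n. real ((i + Suc j) choose Suc j) * (1 - v) ^ i)"
  let ?Q = "\<lambda>v::real. 1 / v ^ (j + 1)" and ?Q' = "\<lambda>v::real. - (real j + 1) * (1 / v ^ (Suc j + 1))"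
  \<comment> \<open>Both sides equal \<open>(i + j + 1)! / (i! * j!)\<close>. This matches the
    coefficients of the differentiated polynomial with those of the next jet.\<close>
  have c: "real (Suc i) * real ((Suc i + j) choose j) = (real j + 1) * real ((i + Suc j) choose Suc j)" for i
  proof -
    have "Suc i * ((Suc i + j) choose j) = Suc j * ((i + Suc j) choose Suc j)"
      using Suc_times_binomial_add[of j i]
      by (simp add: add.commute del: binomial_Suc_Suc mult_Suc)
    then show ?thesis by (metis of_nat_Suc of_nat_mult add.commute)
  qed
  have P: "(?P has_real_derivative ?P' v) (at v)" for v
  proof -
    have "(?P has_real_derivative
        (\<Sum>i\<le>Suc n. real ((i + j) choose j) * (real i * (1 - v) ^ (i - 1) * (-1)))) (at v)"
      by (auto intro!: derivative_eq_intros sum.cong simp del: sum.atMost_Suc)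
    also have "(\<Sum>i\<le>Suc n. real ((i + j) choose j) * (real i * (1 - v) ^ (i - 1) * (-1))) =
        (\<Sum>i\<le>n. - (real (Suc i) * real ((Suc i + j) choose j)) * (1 - v) ^ i)"
      by (subst sum.atMost_Suc_shift) (auto intro!: sum.cong)
    also have "\<dots> = ?P' v"
      unfolding c sum_distrib_left by (rule sum.cong[OF refl], simp only: mult_minus_left mult.assoc)
    finally show ?thesis .
  qed
  have Q: "(?Q has_real_derivative ?Q' v) (at v)" if "v \<ge> 1" for v
  proof -
    have "(?Q has_real_derivative
        - (inverse (v ^ Suc j) * (real (Suc j) * v ^ j) * inverse (v ^ Suc j))) (at v)"
      using DERIV_inverse_fun[OF DERIV_pow[of "Suc j" v]] that by (simp add: inverse_eq_divide)
    also have "- (inverse (v ^ Suc j) * (real (Suc j) * v ^ j) * inverse (v ^ Suc j)) = ?Q' v"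
      using that by (simp add: field_simps)
    finally show ?thesis .
  qed
  have "((\<lambda>v. if v \<in> {..1} then ?P v else ?Q v) has_vector_derivative
     (if v \<in> {..1} then ?P' v else ?Q' v)) (at v within UNIV)"
  proof (rule has_vector_derivative_If_within_closures[where T = "{1<..}"])
    show "(?P has_vector_derivative ?P' v) (at v within S)" for S
      using P[of v, THEN DERIV_subset, of S]
      by (simp only: has_real_derivative_iff_has_vector_derivative subset_UNIV)
    show "(?Q has_vector_derivative ?Q' v) (at v within S)"
      if "v \<in> {1<..} \<union> closure {..1} \<inter> closure {1<..}" for S
    proof -
      have "1 \<le> v" using that by auto
      then show ?thesis
        using Q[of v, THEN DERIV_subset, of S]
        by (simp only: has_real_derivative_iff_has_vector_derivative subset_UNIV)
    qed
    \<comment> \<open>The two closed half-lines meet only at 1. There only the summand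
      \<open>i = 0\<close> survives, so both functions take the value 1 and both derivatives the
      value \<open>- (j + 1)\<close>.\<close>
    assume "v \<in> closure {..1}" "v \<in> closure {1<..}"
    then have "v = 1" by auto
    then show "?P v = ?Q v" "?P' v = ?Q' v"
      using sum_atMost_zero_power[of "\<lambda>i. real ((i + j) choose j)" "Suc n"]
        sum_atMost_zero_power[of "\<lambda>i. real ((i + Suc j) choose Suc j)" n]
      by (simp_all del: sum.atMost_Suc binomial_Suc_Suc)
  qed auto
  moreover have "(if v \<in> {..1} then ?P' v else ?Q' v) = - (real j + 1) * inverse_power_jet n (Suc j) v"
    by (simp add: inverse_power_jet_def)
  moreover have "(\<lambda>v. if v \<in> {..1} then ?P v else ?Q v) = inverse_power_jet (Suc n) j"
    by (simp add: inverse_power_jet_def[abs_def] del: sum.atMost_Suc)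
  ultimately show ?thesis
    by (simp add: has_real_derivative_iff_has_vector_derivative)
qed

lemma continuous_on_inverse_power_jet: "continuous_on UNIV (inverse_power_jet n j)"
proof -
  have "continuous_on ({..1} \<union> {1..}) (\<lambda>v. if v \<le> 1 then (\<Sum>i\<le>n. real ((i + j) choose j) * (1 - v) ^ i)
      else 1 / v ^ (j + 1))"
    using sum_atMost_zero_power[of "\<lambda>i. real ((i + j) choose j)" n]
    by (intro continuous_on_If) (auto intro!: continuous_intros)
  moreover have "{..1::real} \<union> {1..} = UNIV" by auto
  ultimately show ?thesis
    by (simp add: inverse_power_jet_def[abs_def])
qed

text \<open>For \<open>\<bar>u\<bar> \<le> 1\<close> the powers of \<open>1 - u^2\<close> lie in the
  unit interval, so the sum of the coefficients is a bound. For larger \<open>\<bar>u\<bar>\<close>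
  the expression has absolute value \<open>\<bar>u\<bar> ^ a / \<bar>u\<bar> ^ (2 * j + 2)\<close>,
  and the condition on \<open>a\<close> makes this at most \<open>1 / \<bar>u\<bar>\<close>. The
  factor 2 absorbs the passage to \<open>1 + \<bar>u\<bar>\<close> in both ranges.\<close>

lemma power_times_jet_bound:
  assumes "a \<le> 2 * j + 1"
  shows "\<exists>C. \<forall>u. \<bar>u ^ a * inverse_power_jet n j (u\<^sup>2)\<bar> \<le> C / (1 + \<bar>u\<bar>)"
proof -
  let ?C = "(\<Sum>i\<le>n. real ((i + j) choose j))"
  have C1: "1 \<le> ?C"
    using member_le_sum[of 0 "{..n}" "\<lambda>i. real ((i + j) choose j)"] by auto
  have "\<bar>u ^ a * inverse_power_jet n j (u\<^sup>2)\<bar> \<le> 2 * ?C / (1 + \<bar>u\<bar>)" for u :: real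
  proof (cases "\<bar>u\<bar> \<le> 1")
    case True
    then have u2: "u\<^sup>2 \<le> 1" by (simp add: abs_square_le_1)
    have "\<bar>\<Sum>i\<le>n. real ((i + j) choose j) * (1 - u\<^sup>2) ^ i\<bar>
        \<le> (\<Sum>i\<le>n. \<bar>real ((i + j) choose j) * (1 - u\<^sup>2) ^ i\<bar>)"
      by (rule sum_abs)
    also have "\<dots> \<le> ?C"
      using u2 by (intro sum_mono) (auto simp: abs_mult intro!: mult_left_le power_le_one)
    finally have "\<bar>inverse_power_jet n j (u\<^sup>2)\<bar> \<le> ?C"
      using u2 by (simp add: inverse_power_jet_def)
    moreover have "\<bar>u ^ a\<bar> \<le> 1" using True by (simp add: power_abs power_le_one)
    ultimately have "\<bar>u ^ a * inverse_power_jet n j (u\<^sup>2)\<bar> \<le> 1 * ?C"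
      unfolding abs_mult by (intro mult_mono) auto
    also have "?C * (1 + \<bar>u\<bar>) \<le> ?C * 2"
      using True C1 by (intro mult_left_mono) auto
    then have "1 * ?C \<le> 2 * ?C / (1 + \<bar>u\<bar>)" by (simp add: field_simps)
    finally show ?thesis .
  next
    case False
    then have u: "1 < \<bar>u\<bar>" by simp
    then have u2: "\<not> u\<^sup>2 \<le> 1" by (simp add: abs_square_le_1)
    have "(u\<^sup>2) ^ (j + 1) = \<bar>u\<bar> ^ (2 * (j + 1))"
      by (simp only: power_mult power2_abs)
    then have "\<bar>u ^ a * inverse_power_jet n j (u\<^sup>2)\<bar> = \<bar>u\<bar> ^ a / \<bar>u\<bar> ^ (2 * (j + 1))"
      using u2 by (simp only: inverse_power_jet_def if_False abs_mult power_abs abs_divide abs_one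
          abs_abs times_divide_eq_right mult_1_right)
    also have "\<dots> \<le> \<bar>u\<bar> ^ (2 * j + 1) / \<bar>u\<bar> ^ (2 * (j + 1))"
      using u assms by (intro divide_right_mono power_increasing) auto
    also have "\<dots> = 1 / \<bar>u\<bar>" using u by simp
    also have "\<dots> \<le> 2 / (1 + \<bar>u\<bar>)" using u by (simp add: field_simps)
    also have "\<dots> \<le> 2 * ?C / (1 + \<bar>u\<bar>)" using C1 by (intro divide_right_mono) auto
    finally show ?thesis .
  qed
  then show ?thesis by blast
qed

lemma continuous_on_power_times_jet: "continuous_on UNIV (\<lambda>u. u ^ a * inverse_power_jet n j (u\<^sup>2))"
  by (intro continuous_intros continuous_on_compose2[OF continuous_on_inverse_power_jet]) auto

lemma decaying_kernel_lincomb: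
  assumes "decaying_kernel n \<kappa>" "decaying_kernel n \<kappa>'"
  shows "decaying_kernel n (\<lambda>i u. c * \<kappa> i u + d * \<kappa>' i u)"
proof -
  obtain C C' where C: "\<And>j u. j \<le> n \<Longrightarrow> \<bar>\<kappa> j u\<bar> \<le> C / (1 + \<bar>u\<bar>)"
    and C': "\<And>j u. j \<le> n \<Longrightarrow> \<bar>\<kappa>' j u\<bar> \<le> C' / (1 + \<bar>u\<bar>)"
    using assms unfolding decaying_kernel_def by meson
  have "\<bar>c * \<kappa> j u + d * \<kappa>' j u\<bar> \<le> (\<bar>c\<bar> * C + \<bar>d\<bar> * C') / (1 + \<bar>u\<bar>)" if "j \<le> n" for j u
    using mult_left_mono[OF C[OF that, of u], of "\<bar>c\<bar>"] mult_left_mono[OF C'[OF that, of u], of "\<bar>d\<bar>"]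
      abs_triangle_ineq[of "c * \<kappa> j u" "d * \<kappa>' j u"]
    by (simp add: abs_mult add_divide_distrib)
  then show ?thesis
    using assms unfolding decaying_kernel_def
    by (auto intro!: derivative_eq_intros continuous_intros)
qed

text \<open>Puts an antiderivative in front and shifts the indices by one, so that a family can be
  built starting from the derivative of its zeroth member.\<close>

lemma decaying_kernel_Suc:
  assumes "decaying_kernel n \<kappa>" "\<And>u. (F has_real_derivative \<kappa> 0 u) (at u)"
    "\<And>u. \<bar>F u\<bar> \<le> C / (1 + \<bar>u\<bar>)"
  shows "decaying_kernel (Suc n) (case_nat F \<kappa>)"
proof -
  obtain C' where C': "\<And>j u. j \<le> n \<Longrightarrow> \<bar>\<kappa> j u\<bar> \<le> C' / (1 + \<bar>u\<bar>)"
    using assms unfolding decaying_kernel_def by meson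
  have "\<bar>case_nat F \<kappa> j u\<bar> \<le> max C C' / (1 + \<bar>u\<bar>)" if "j \<le> Suc n" for j u
    using that order_trans[OF C'[of "j - 1" u] divide_right_mono[of C' "max C C'" "1 + \<bar>u\<bar>"]]
      order_trans[OF assms(3)[of u] divide_right_mono[of C "max C C'" "1 + \<bar>u\<bar>"]]
    by (cases j) auto
  moreover have "continuous_on UNIV F"
    using assms(2) by (meson DERIV_isCont continuous_at_imp_continuous_on)
  then have "continuous_on UNIV (case_nat F \<kappa> j)" if "j \<le> Suc n" for j
    using assms(1) that by (auto simp: decaying_kernel_def split: nat.split)
  moreover have "(case_nat F \<kappa> j has_real_derivative case_nat F \<kappa> (Suc j) u) (at u)" if "j < Suc n" for j u
    using assms(1,2) that by (auto simp: decaying_kernel_def split: nat.split)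
  ultimately show ?thesis
    unfolding decaying_kernel_def by blast
qed

text \<open>Write \<open>J n j\<close> for the jet. The derivative of
  \<open>u ^ a * J n j (u^2)\<close> is \<open>a * u ^ (a - 1) * J n j (u^2) - 2 * (j + 1) * u ^ (a
  + 1) * J (n - 1) (j + 1) (u^2)\<close>. Both terms have the same form, and
  \<open>a \<le> 2 * j + 1\<close> persists because raising \<open>a\<close> by one comes with
  raising \<open>j\<close> by one. Hence induction on \<open>m\<close>.\<close>

lemma decaying_kernel_power_times_jet:
  assumes "m \<le> n" "a \<le> 2 * j + 1"
  shows "\<exists>\<kappa>. decaying_kernel m \<kappa> \<and> \<kappa> 0 = (\<lambda>u. u ^ a * inverse_power_jet n j (u\<^sup>2))"
  using assms
proof (induction m arbitrary: n a j)
  case 0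
  then show ?case
    using power_times_jet_bound[OF 0(2), of n] continuous_on_power_times_jet[of a n j]
    by (intro exI[of _ "\<lambda>_ u. u ^ a * inverse_power_jet n j (u\<^sup>2)"]) (auto simp: decaying_kernel_def)
next
  case (Suc m)
  then obtain n' where n: "n = Suc n'" "m \<le> n'" by (cases n) auto
  \<comment> \<open>For \<open>a = 0\<close> the natural number \<open>a - 1\<close> is 0, but this
    term then enters with the coefficient \<open>real a = 0\<close>.\<close>
  obtain \<kappa>1 where \<kappa>1: "decaying_kernel m \<kappa>1" "\<kappa>1 0 = (\<lambda>u. u ^ (a - 1) * inverse_power_jet n j (u\<^sup>2))"
    using Suc.IH[OF Suc_leD[OF Suc.prems(1)] le_trans[OF diff_le_self[of a 1] Suc.prems(2)]] by blast
  obtain \<kappa>2 where \<kappa>2: "decaying_kernel m \<kappa>2" "\<kappa>2 0 = (\<lambda>u. u ^ (a + 1) * inverse_power_jet n' (Suc j) (u\<^sup>2))"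
    using Suc.IH[of n' "a + 1" "Suc j"] n Suc.prems by auto
  let ?F = "\<lambda>u. u ^ a * inverse_power_jet n j (u\<^sup>2)"
  let ?\<kappa> = "\<lambda>i u. real a * \<kappa>1 i u + (- 2 * (real j + 1)) * \<kappa>2 i u"
  obtain C where C: "\<And>u. \<bar>?F u\<bar> \<le> C / (1 + \<bar>u\<bar>)"
    using power_times_jet_bound[OF Suc.prems(2), of n] by blast
  have d: "(?F has_real_derivative ?\<kappa> 0 u) (at u)" for u
  proof -
    have 1: "((\<lambda>u. inverse_power_jet n j (u\<^sup>2)) has_real_derivative
        (- (real j + 1) * inverse_power_jet n' (Suc j) (u\<^sup>2)) * (2 * u)) (at u)"
      unfolding n(1)
      by (rule DERIV_chain2[OF has_real_derivative_inverse_power_jet])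
        (auto intro!: derivative_eq_intros)
    show ?thesis
      unfolding \<kappa>1(2) \<kappa>2(2)
      by (rule derivative_eq_intros 1 refl)+ (simp add: algebra_simps)
  qed
  have "decaying_kernel (Suc m) (case_nat ?F ?\<kappa>)"
    using decaying_kernel_Suc[OF decaying_kernel_lincomb[OF \<kappa>1(1) \<kappa>2(1)] d C] .
  moreover have "case_nat ?F ?\<kappa> 0 = ?F" by simp
  ultimately show ?case by blast
qed

text \<open>This dilation leaves \<open>1 / u\<close> invariant and shrinks the region where the
  kernel differs from it. Since \<delta> is at most 1, \<open>\<bar>u / \<delta>\<bar>\<close> is at
  least \<open>\<bar>u\<bar>\<close> and \<open>1 / \<delta> ^ Suc n\<close> dominates the factors
  of all lower orders, so one constant serves.\<close>

lemma decaying_kernel_rescale: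
  assumes "decaying_kernel n \<kappa>" "0 < \<delta>" "\<delta> \<le> 1"
  shows "decaying_kernel n (\<lambda>j u. \<kappa> j (u / \<delta>) / \<delta> ^ Suc j)"
proof -
  obtain C where C: "\<And>j u. j \<le> n \<Longrightarrow> \<bar>\<kappa> j u\<bar> \<le> C / (1 + \<bar>u\<bar>)"
    using assms unfolding decaying_kernel_def by meson
  have C0: "0 \<le> C" using C[of 0 0] by simp
  have "\<bar>\<kappa> j (u / \<delta>) / \<delta> ^ Suc j\<bar> \<le> (C / \<delta> ^ Suc n) / (1 + \<bar>u\<bar>)" if "j \<le> n" for j u
  proof -
    have "\<bar>\<kappa> j (u / \<delta>)\<bar> \<le> C / (1 + \<bar>u / \<delta>\<bar>)" using C[OF that, of "u / \<delta>"] .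
    also have "\<dots> \<le> C / (1 + \<bar>u\<bar>)"
    proof (intro divide_left_mono C0)
      have "\<bar>u\<bar> * \<delta> \<le> \<bar>u\<bar>" using assms by (intro mult_left_le) auto
      then show "1 + \<bar>u\<bar> \<le> 1 + \<bar>u / \<delta>\<bar>" using assms by (simp add: field_simps)
    qed (auto intro!: mult_pos_pos add_pos_nonneg)
    finally have 1: "\<bar>\<kappa> j (u / \<delta>)\<bar> \<le> C / (1 + \<bar>u\<bar>)" .
    have 2: "\<delta> ^ Suc n \<le> \<delta> ^ Suc j" using assms that by (intro power_decreasing) auto
    have "\<bar>\<kappa> j (u / \<delta>) / \<delta> ^ Suc j\<bar> = \<bar>\<kappa> j (u / \<delta>)\<bar> / \<delta> ^ Suc j"
      using assms by (simp add: abs_divide)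
    also have "\<dots> \<le> (C / (1 + \<bar>u\<bar>)) / \<delta> ^ Suc n"
      using 1 2 assms by (intro frac_le) auto
    finally show ?thesis by (simp add: field_simps)
  qed
  moreover have "((\<lambda>u. \<kappa> j (u / \<delta>) / \<delta> ^ Suc j) has_real_derivative \<kappa> (Suc j) (u / \<delta>) / \<delta> ^ Suc (Suc j)) (at u)"
    if "j < n" for j u
  proof -
    have 1: "(\<kappa> j has_real_derivative \<kappa> (Suc j) (u / \<delta>)) (at (u / \<delta>))"
      using assms that by (simp add: decaying_kernel_def)
    have "((\<lambda>u. \<kappa> j (u / \<delta>)) has_real_derivative \<kappa> (Suc j) (u / \<delta>) * (1 / \<delta>)) (at u)"
      by (rule DERIV_chain2[where g = "\<lambda>u. u / \<delta>", OF 1]) (use assms in \<open>auto intro!: derivative_eq_intros\<close>)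
    from DERIV_cdivide[OF this, of "\<delta> ^ Suc j"] show ?thesis by (simp add: mult.assoc)
  qed
  moreover have "continuous_on UNIV (\<lambda>u. \<kappa> j (u / \<delta>) / \<delta> ^ Suc j)" if "j \<le> n" for j
  proof -
    have "continuous_on UNIV (\<kappa> j)" using assms(1) that by (simp add: decaying_kernel_def)
    moreover have "continuous_on UNIV (\<lambda>u. u / \<delta>)" using assms by (intro continuous_intros) auto
    ultimately have "continuous_on UNIV (\<lambda>u. \<kappa> j (u / \<delta>))"
      by (rule continuous_on_compose2) simp
    then show ?thesis using assms by (intro continuous_on_divide continuous_on_const) auto
  qed
  ultimately show ?thesis unfolding decaying_kernel_def by blast
qed

text \<open>The kernel is a dilate of \<open>u * inverse_power_jet n 0 (u^2)\<close>: odd, because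
  the second factor is even, and equal to \<open>u / u^2\<close> beyond
  \<open>\<bar>u\<bar> = 1\<close>.\<close>

lemma smooth_truncation_of_Hilbert_kernel:
  assumes "0 < \<delta>" "\<delta> \<le> 1"
  obtains \<kappa> where "decaying_kernel n \<kappa>" "\<And>u. \<kappa> 0 (- u) = - \<kappa> 0 u"
    "\<And>u. \<delta> \<le> \<bar>u\<bar> \<Longrightarrow> \<kappa> 0 u = 1 / u"
proof -
  obtain \<kappa> where \<kappa>: "decaying_kernel n \<kappa>" "\<kappa> 0 = (\<lambda>u. u * inverse_power_jet n 0 (u\<^sup>2))"
    using decaying_kernel_power_times_jet[of n n 1 0] by auto
  have far: "\<kappa> 0 u = 1 / u" if u: "1 \<le> \<bar>u\<bar>" for u
  proof (cases "\<bar>u\<bar> = 1")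
    \<comment> \<open>At \<open>\<bar>u\<bar> = 1\<close> the definition is in its polynomial
      branch, whose value there is 1.\<close>
    case True
    then have "u\<^sup>2 = 1" "u = 1 / u" using power2_abs[of u] by (auto simp: abs_if split: if_splits)
    then show ?thesis using sum_atMost_zero_power[of "\<lambda>_. 1" n]
      by (simp add: \<kappa>(2) inverse_power_jet_def)
  next
    case False
    then have "\<not> u\<^sup>2 \<le> 1" using u by (simp add: abs_square_le_1)
    then show ?thesis by (auto simp: \<kappa>(2) inverse_power_jet_def power2_eq_square field_simps)
  qed
  show thesis
  proof
    show "decaying_kernel n (\<lambda>j u. \<kappa> j (u / \<delta>) / \<delta> ^ Suc j)"
      by (rule decaying_kernel_rescale[OF \<kappa>(1) assms])
    show "\<kappa> 0 (- u / \<delta>) / \<delta> ^ Suc 0 = - (\<kappa> 0 (u / \<delta>) / \<delta> ^ Suc 0)" for u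
      by (simp add: \<kappa>(2))
    show "\<kappa> 0 (u / \<delta>) / \<delta> ^ Suc 0 = 1 / u" if "\<delta> \<le> \<bar>u\<bar>" for u
      using far[of "u / \<delta>"] assms that by (simp add: abs_divide)
  qed
qed

section \<open>The far part of the Hilbert transform\<close>

lemma borel_measurable_lebesgueI:
  fixes g :: "real \<Rightarrow> 'b::topological_space"
  shows "g \<in> borel_measurable borel \<Longrightarrow> g \<in> borel_measurable lebesgue"
  by (simp add: measurable_completion)

lemma integrable_lebesgue_affine:
  fixes h :: "real \<Rightarrow> 'a::euclidean_space"
  assumes "integrable lebesgue h" "c \<noteq> 0"
  shows "integrable lebesgue (\<lambda>u. h (x + c * u))"
  using assms(1) lebesgue_integrable_real_affine_iff[OF assms(2), of h x] by simp

lemma integrable_abs_powr_near_0: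
  fixes a c :: real
  assumes "-1 < a"
  shows "integrable lebesgue (\<lambda>u. indicator {-c<..<c} u * \<bar>u\<bar> powr a)"
proof -
  \<comment> \<open>The maximum keeps the right endpoint nonnegative; for \<open>c \<le> 0\<close>
    the interval in the claim is empty. The two-sided function is dominated by \<open>h\<close> plus
    its reflection.\<close>
  define h where "h u = indicator {0..max 0 c} u *\<^sub>R u powr a" for u :: real
  have "set_integrable lebesgue {0..max 0 c} (\<lambda>u. u powr a)"
    by (rule nonnegative_absolutely_integrable_1[OF integrable_on_powr_from_0[OF assms]]) auto
  then have h: "integrable lebesgue h"
    by (simp add: set_integrable_def h_def[abs_def])
  have "integrable lebesgue (\<lambda>u. h u + h (0 + (-1) * u))"
    by (intro Bochner_Integration.integrable_add h integrable_lebesgue_affine) simp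
  then show ?thesis
  proof (rule Bochner_Integration.integrable_bound)
    show "(\<lambda>u. indicator {-c<..<c} u * \<bar>u\<bar> powr a) \<in> borel_measurable lebesgue"
      by (rule borel_measurable_lebesgueI) measurable
  qed (auto simp: h_def indicator_def)
qed

lemma integrable_one_plus_abs_powr:
  fixes q :: real
  assumes "1 < q"
  shows "integrable lebesgue (\<lambda>t::real. (1 + \<bar>t\<bar>) powr - q)"
proof -
  define h where "h t = indicator {1..} t *\<^sub>R t powr - q" for t :: real
  have "(\<lambda>t. t powr - q) integrable_on {1..}"
    using has_integral_powr_to_inf[of "-q" 1] assms by (auto simp: integrable_on_def)
  then have "set_integrable lebesgue {1..} (\<lambda>t. t powr - q)"
    by (rule nonnegative_absolutely_integrable_1) auto
  then have h: "integrable lebesgue h"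
    by (simp add: set_integrable_def h_def[abs_def])
  have "integrable lebesgue (\<lambda>t. h (1 + 1 * t) + h (1 + (-1) * t))"
    by (intro Bochner_Integration.integrable_add integrable_lebesgue_affine h) simp_all
  then show ?thesis
  proof (rule Bochner_Integration.integrable_bound)
    show "(\<lambda>t::real. (1 + \<bar>t\<bar>) powr - q) \<in> borel_measurable lebesgue"
      by (rule borel_measurable_lebesgueI) measurable
  qed (auto simp: h_def indicator_def)
qed

text \<open>Here the integrability of \<open>norm (f t) powr p\<close> is turned into the weighted
  bound on which all later integrals rest. For \<open>p = 1\<close> the weight is at most 1; for
  \<open>p > 1\<close> a Young inequality with the conjugate exponent \<open>q\<close> applies, and
  \<open>(1 + \<bar>t\<bar>) powr - q\<close> is integrable because \<open>q > 1\<close>.\<close>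

lemma in_Lp_imp_integrable_weighted:
  fixes f :: "real \<Rightarrow> 'a::{real_normed_field,euclidean_space}"
  assumes "1 \<le> p" "in_Lp p f"
  shows "integrable lebesgue (\<lambda>t. norm (f t) / (1 + \<bar>t\<bar>))"
proof -
  have f [measurable]: "f \<in> borel_measurable lebesgue"
    and fp: "integrable lebesgue (\<lambda>t. norm (f t) powr p)"
    using assms(2) by (auto simp: in_Lp_def)
  have [measurable]: "(\<lambda>t::real. 1 + \<bar>t\<bar>) \<in> borel_measurable lebesgue"
    by (rule borel_measurable_lebesgueI) simp
  have m: "(\<lambda>t. norm (f t) / (1 + \<bar>t\<bar>)) \<in> borel_measurable lebesgue"
    by measurable
  show ?thesis
  proof (cases "p = 1")
    case True
    have "norm (f t) / (1 + \<bar>t\<bar>) \<le> norm (f t)" for t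
      by (simp add: divide_le_eq mult_left_le mult_le_cancel_left1)
    then show ?thesis
      using True by (intro Bochner_Integration.integrable_bound[OF fp m]) auto
  next
    case False
    then have p: "p > 1" using assms by simp
    define q where "q = p / (p - 1)"
    have q: "q > 1" "q = 1 / (p - 1) + 1" using p by (auto simp: q_def field_simps)
    \<comment> \<open>If \<open>1 / b\<close> is at most \<open>a powr (p - 1)\<close>, then
      \<open>a / b\<close> is at most \<open>a powr p\<close>. Otherwise \<open>a\<close> is at most
      \<open>b powr - (1 / (p - 1))\<close>, and dividing by \<open>b\<close> gives the exponent
      \<open>- q\<close>.\<close>
    have young: "a / b \<le> a powr p + b powr - q" if "a \<ge> 0" "b \<ge> 1" for a b :: real
    proof (cases "a powr (p - 1) \<ge> 1 / b")
      case True
      have "a / b \<le> a * a powr (p - 1)" using mult_left_mono[OF True that(1)] by simp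
      also have "\<dots> = a powr p"
        using that p by (cases "a = 0") (auto simp: powr_diff)
      finally show ?thesis by (simp add: add_increasing2)
    next
      case False
      have "a = (a powr (p - 1)) powr (1 / (p - 1))"
        using p that by (simp add: powr_powr)
      also have "\<dots> \<le> (1 / b) powr (1 / (p - 1))"
        using False p by (intro powr_mono2) auto
      also have "\<dots> = b powr - (1 / (p - 1))"
        using that by (simp add: powr_minus_divide powr_divide)
      finally have "a / b \<le> b powr - (1 / (p - 1)) / b"
        using that by (intro divide_right_mono) auto
      also have "\<dots> = b powr - q"
        using that by (simp add: q(2) powr_diff powr_minus_divide powr_add)
      finally show ?thesis by (simp add: add_increasing)
    qed
    show ?thesis
      using Bochner_Integration.integrable_add[OF fp integrable_one_plus_abs_powr[OF q(1)]] m
      by (rule Bochner_Integration.integrable_bound) (use young in \<open>auto\<close>)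
  qed
qed

section \<open>Convolution of \<open>f\<close> with kernels of decay
  \<open>1 / (1 + \<bar>u\<bar>)\<close>\<close>

lemma one_plus_abs_diff: "1 / (1 + \<bar>x - t\<bar>) \<le> (1 + \<bar>x\<bar>) / (1 + \<bar>t\<bar>)" for x t :: real
proof -
  have "1 + \<bar>t\<bar> \<le> (1 + \<bar>x - t\<bar>) + \<bar>x\<bar>" by linarith
  also have "\<dots> \<le> (1 + \<bar>x\<bar>) * (1 + \<bar>x - t\<bar>)" by (simp add: algebra_simps)
  finally show ?thesis by (simp add: field_simps)
qed

text \<open>By the Peetre-type inequality \<open>one_plus_abs_diff\<close> the weight is recentred
  from \<open>x\<close> to 0 at the price of the factor \<open>1 + \<bar>x\<bar>\<close>, so one
  majorant in \<open>t\<close> serves all \<open>x\<close> in a bounded set.\<close>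

lemma decay_translate_bound:
  fixes g :: "real \<Rightarrow> real"
  assumes "\<And>u. \<bar>g u\<bar> \<le> C / (1 + \<bar>u\<bar>)"
  shows "\<bar>g (x - t)\<bar> \<le> C * (1 + \<bar>x\<bar>) / (1 + \<bar>t\<bar>)"
proof -
  have "0 \<le> C" using assms[of 0] by simp
  then show ?thesis
    using assms[of "x - t"] mult_left_mono[OF one_plus_abs_diff[of x t], of C] by simp
qed

text \<open>Serves two kinds of kernel: the smooth \<open>\<kappa> j\<close>, and the singular part
  of \<open>1 / u\<close> cut off at \<open>\<epsilon> < \<bar>u\<bar>\<close>.\<close>

lemma integrable_decay_convolution:
  fixes f :: "real \<Rightarrow> 'a::euclidean_space"
  assumes [measurable]: "f \<in> borel_measurable lebesgue"
    and f: "integrable lebesgue (\<lambda>t. norm (f t) / (1 + \<bar>t\<bar>))"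
    and g: "g \<in> borel_measurable borel" "\<And>u. \<bar>g u\<bar> \<le> C / (1 + \<bar>u\<bar>)"
  shows "integrable lebesgue (\<lambda>t. g (x - t) *\<^sub>R f t)"
proof (rule Bochner_Integration.integrable_bound)
  show "integrable lebesgue (\<lambda>t. C * (1 + \<bar>x\<bar>) * (norm (f t) / (1 + \<bar>t\<bar>)))"
    using f by (rule integrable_mult_right)
  have [measurable]: "(\<lambda>t. g (x - t)) \<in> borel_measurable lebesgue"
    by (intro borel_measurable_lebesgueI measurable_compose[OF _ g(1)]) simp
  show "(\<lambda>t. g (x - t) *\<^sub>R f t) \<in> borel_measurable lebesgue"
    by measurable
  have "norm (g (x - t) *\<^sub>R f t) \<le> C * (1 + \<bar>x\<bar>) * (norm (f t) / (1 + \<bar>t\<bar>))" for t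
    using mult_right_mono[OF decay_translate_bound[OF g(2), of x t] norm_ge_zero[of "f t"]] by simp
  then show "AE t in lebesgue. norm (g (x - t) *\<^sub>R f t) \<le> norm (C * (1 + \<bar>x\<bar>) * (norm (f t) / (1 + \<bar>t\<bar>)))"
    by (intro AE_I2) (smt (verit) real_norm_def)
qed

text \<open>One kernel derivative more than \<open>k\<close> is available, so by the mean value
  inequality each \<open>\<kappa> j\<close> with \<open>j \<le> k\<close> is Lipschitz, with a
  constant of size \<open>1 / (1 + \<bar>t\<bar>)\<close> after translation. This supplies the
  integrable Hoelder modulus.\<close>

lemma derivative_chain_decay_convolution:
  fixes f :: "real \<Rightarrow> 'a::euclidean_space"
  assumes fm: "f \<in> borel_measurable lebesgue"
    and f: "integrable lebesgue (\<lambda>t. norm (f t) / (1 + \<bar>t\<bar>))"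
    and \<kappa>: "decaying_kernel (Suc k) \<kappa>"
    and \<beta>: "0 < \<beta>" "\<beta> \<le> 1" and \<delta>: "\<delta> \<le> 1 / 2"
  shows "derivative_chain k \<beta> {x0 - \<delta><..<x0 + \<delta>} (\<lambda>j x. \<integral>t. \<kappa> j (x - t) *\<^sub>R f t \<partial>lebesgue)"
proof -
  let ?S = "{x0 - \<delta><..<x0 + \<delta>}"
  obtain C where C: "\<And>j u. j \<le> Suc k \<Longrightarrow> \<bar>\<kappa> j u\<bar> \<le> C / (1 + \<bar>u\<bar>)"
    using \<kappa> unfolding decaying_kernel_def by meson
  have C0: "0 \<le> C" using C[of 0 0] by simp
  have der: "(\<kappa> j has_real_derivative \<kappa> (Suc j) u) (at u)" if "j \<le> k" for j u
    using \<kappa> that by (simp add: decaying_kernel_def)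
  have dert: "((\<lambda>x. \<kappa> j (x - t)) has_real_derivative \<kappa> (Suc j) (x - t)) (at x)" if "j \<le> k" for j x t
  proof -
    have "((\<lambda>x. x - t) has_real_derivative 1) (at x)" by (auto intro!: derivative_eq_intros)
    from DERIV_chain2[where g = "\<lambda>x. x - t", OF der[OF that] this] show ?thesis by simp
  qed
  \<comment> \<open>For \<open>z\<close> in \<open>?S\<close> the factor
    \<open>1 + \<bar>z\<bar>\<close> is at most \<open>2 + \<bar>x0\<bar>\<close>.\<close>
  let ?D = "C * (2 + \<bar>x0\<bar>)"
  have lip: "\<bar>\<kappa> j (x - t) - \<kappa> j (y - t)\<bar> \<le> ?D / (1 + \<bar>t\<bar>) * \<bar>x - y\<bar>"
    if "j \<le> k" "x \<in> ?S" "y \<in> ?S" for j x y t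
  proof -
    have "norm (\<kappa> j (x - t) - \<kappa> j (y - t)) \<le> ?D / (1 + \<bar>t\<bar>) * norm (x - y)"
    proof (rule field_differentiable_bound[where S = ?S])
      fix z assume z: "z \<in> ?S"
      show "((\<lambda>x. \<kappa> j (x - t)) has_field_derivative \<kappa> (Suc j) (z - t)) (at z within ?S)"
        using dert[OF that(1)] by (rule DERIV_subset) simp
      have "\<bar>\<kappa> (Suc j) (z - t)\<bar> \<le> C * (1 + \<bar>z\<bar>) / (1 + \<bar>t\<bar>)"
        using decay_translate_bound C that(1) by (meson Suc_le_mono)
      also have "\<dots> \<le> ?D / (1 + \<bar>t\<bar>)"
        using z \<delta> C0 by (intro divide_right_mono mult_left_mono) auto
      finally show "norm (\<kappa> (Suc j) (z - t)) \<le> ?D / (1 + \<bar>t\<bar>)" by simp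
    qed (use that in auto)
    then show ?thesis by simp
  qed
  \<comment> \<open>The interval has length at most 1, so a Lipschitz bound is also a Hoelder bound
    of exponent \<beta>.\<close>
  have lip': "\<bar>x - y\<bar> \<le> \<bar>x - y\<bar> powr \<beta>" if "x \<in> ?S" "y \<in> ?S" for x y
    using powr_mono'[of \<beta> 1 "\<bar>x - y\<bar>"] \<beta> \<delta> that by auto
  show ?thesis
  proof (rule derivative_chain_integral[where w = "\<lambda>j t. ?D * (norm (f t) / (1 + \<bar>t\<bar>))"])
    show "integrable lebesgue (\<lambda>t. \<kappa> j (x - t) *\<^sub>R f t)" if "j \<le> k" for j x
    proof (rule integrable_decay_convolution[OF fm f])
      show "\<kappa> j \<in> borel_measurable borel"
        using \<kappa> that by (intro borel_measurable_continuous_onI) (simp add: decaying_kernel_def)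
      show "\<And>u. \<bar>\<kappa> j u\<bar> \<le> C / (1 + \<bar>u\<bar>)" using C that by simp
    qed
    show "((\<lambda>x. \<kappa> j (x - t) *\<^sub>R f t) has_vector_derivative \<kappa> (Suc j) (x - t) *\<^sub>R f t) (at x)"
      if "j < k" for j x t
      using has_vector_derivative_scaleR[OF dert[of j t x], of "\<lambda>_. f t" 0] that
      by (simp add: has_vector_derivative_const)
    show "norm (\<kappa> j (x - t) *\<^sub>R f t - \<kappa> j (y - t) *\<^sub>R f t)
        \<le> \<bar>x - y\<bar> powr \<beta> * (?D * (norm (f t) / (1 + \<bar>t\<bar>)))"
      if "j \<le> k" "x \<in> ?S" "y \<in> ?S" for j x y t
    proof -
      have "?D / (1 + \<bar>t\<bar>) * \<bar>x - y\<bar> \<le> ?D / (1 + \<bar>t\<bar>) * \<bar>x - y\<bar> powr \<beta>"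
        using lip'[OF that(2,3)] C0 by (intro mult_left_mono) auto
      with lip[OF that, of t]
      have "\<bar>\<kappa> j (x - t) - \<kappa> j (y - t)\<bar> * norm (f t) \<le> (?D / (1 + \<bar>t\<bar>) * \<bar>x - y\<bar> powr \<beta>) * norm (f t)"
        by (intro mult_right_mono) auto
      then show ?thesis by (simp flip: scaleR_left_diff_distrib add: mult.commute mult.left_commute)
    qed
    show "integrable lebesgue (\<lambda>t. ?D * (norm (f t) / (1 + \<bar>t\<bar>)))"
      using f by (rule integrable_mult_right)
  qed (use \<beta> in auto)
qed

section \<open>Existence of the principal value\<close>

text \<open>Dominated convergence with majorant \<open>norm (h t)\<close>. Away from
  \<open>x\<close> the indicators are eventually 1; at \<open>x\<close> they are always 0, in
  agreement with \<open>h x = 0\<close>.\<close>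

lemma integral_delete_shrinking_interval:
  fixes h :: "real \<Rightarrow> 'a::euclidean_space"
  assumes h: "integrable lebesgue h" and "h x = 0"
  shows "((\<lambda>\<epsilon>. \<integral>t. indicator {t. \<epsilon> < \<bar>x - t\<bar>} t *\<^sub>R h t \<partial>lebesgue) \<longlongrightarrow> (\<integral>t. h t \<partial>lebesgue)) (at_right 0)"
  unfolding tendsto_at_iff_sequentially comp_def
proof (intro allI impI)
  fix X :: "nat \<Rightarrow> real" assume X: "\<forall>i. X i \<in> {0<..} - {0}" "X \<longlonglongrightarrow> 0"
  show "(\<lambda>i. \<integral>t. indicator {t. X i < \<bar>x - t\<bar>} t *\<^sub>R h t \<partial>lebesgue) \<longlonglongrightarrow> (\<integral>t. h t \<partial>lebesgue)"
  proof (rule integral_dominated_convergence[where w = "\<lambda>t. norm (h t)"])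
    have [measurable]: "{t. X i < \<bar>x - t\<bar>} \<in> sets lebesgue" for i
      by (rule sets_completionI_sets) (auto intro!: borel_open open_Collect_less continuous_intros)
    have [measurable]: "h \<in> borel_measurable lebesgue" using h by simp
    show "(\<lambda>t. indicator {t. X i < \<bar>x - t\<bar>} t *\<^sub>R h t) \<in> borel_measurable lebesgue" for i
      by measurable
    have "(\<lambda>i. indicator {t. X i < \<bar>x - t\<bar>} t *\<^sub>R h t) \<longlonglongrightarrow> h t" for t
    proof (cases "t = x")
      case True
      then show ?thesis using assms by simp
    next
      case False
      then have "\<forall>\<^sub>F i in sequentially. X i < \<bar>x - t\<bar>"
        using order_tendstoD(2)[OF X(2), of "\<bar>x - t\<bar>"] by simp
      then show ?thesis
        by (intro tendsto_eventually) (auto elim: eventually_mono)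
    qed
    then show "AE t in lebesgue. (\<lambda>i. indicator {t. X i < \<bar>x - t\<bar>} t *\<^sub>R h t) \<longlonglongrightarrow> h t"
      by simp
  qed (use h in \<open>auto simp: indicator_def\<close>)
qed

text \<open>Reflecting about \<open>x\<close> and using that \<open>E\<close> is odd symmetrises the near part; this is where the
  cancellation behind the principal value comes from. At \<open>u = 0\<close> the splitting of \<open>1 / u\<close>
  reads \<open>0 = 0 + 0\<close>.\<close>
lemma truncated_hilbert_tendsto:
  fixes f :: "real \<Rightarrow> 'a::{real_normed_field,euclidean_space}"
  assumes fm: "f \<in> borel_measurable lebesgue"
    and f: "integrable lebesgue (\<lambda>t. norm (f t) / (1 + \<bar>t\<bar>))"
    and K: "K \<in> borel_measurable borel" "\<And>u. \<bar>K u\<bar> \<le> C / (1 + \<bar>u\<bar>)"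
    and E: "E \<in> borel_measurable borel" "\<And>u. \<bar>E u\<bar> \<le> C' / \<bar>u\<bar>" "\<And>u. E (- u) = - E u"
    and KE: "\<And>u. 1 / u = K u + E u"
    and near: "integrable lebesgue (\<lambda>u. E u *\<^sub>R (f (x - u) - f (x + u)))"
  shows "(truncated_hilbert f x \<longlongrightarrow> (1 / pi) *\<^sub>R ((\<integral>t. K (x - t) *\<^sub>R f t \<partial>lebesgue) +
    (1 / 2) *\<^sub>R (\<integral>u. E u *\<^sub>R (f (x - u) - f (x + u)) \<partial>lebesgue))) (at_right 0)"
proof -
  let ?N = "\<lambda>u. E u *\<^sub>R (f (x - u) - f (x + u))"
  let ?F = "\<lambda>t. K (x - t) *\<^sub>R f t"
  \<comment> \<open>Division by zero gives 0, so the bound at 0 reads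
    \<open>\<bar>E 0\<bar> \<le> 0\<close>. The values \<open>E 0 = 0\<close> and
    \<open>K 0 = 0\<close> make both integrands vanish at the centre of the deleted
    interval.\<close>
  have E0: "E 0 = 0" using E(2)[of 0] by simp
  then have K0: "K 0 = 0" using KE[of 0] by simp
  have C': "0 \<le> C'" using E(2)[of 1] by simp
  have int_F: "integrable lebesgue ?F" by (rule integrable_decay_convolution[OF fm f K])
  have trunc: "(1 / pi) *\<^sub>R ((\<integral>t. indicator {t. \<epsilon> < \<bar>x - t\<bar>} t *\<^sub>R ?F t \<partial>lebesgue) +
      (1 / 2) *\<^sub>R (\<integral>u. indicator {u. \<epsilon> < \<bar>0 - u\<bar>} u *\<^sub>R ?N u \<partial>lebesgue)) = truncated_hilbert f x \<epsilon>"
    if \<epsilon>: "0 < \<epsilon>" for \<epsilon>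
  proof -
    let ?E = "\<lambda>u. indicator {u. \<epsilon> < \<bar>u\<bar>} u * E u"
    let ?g = "\<lambda>t. ?E (x - t) *\<^sub>R f t"
    \<comment> \<open>On the support \<open>1 < \<bar>u\<bar> / \<epsilon>\<close>, hence
      \<open>1 + \<bar>u\<bar> \<le> (1 + 1 / \<epsilon>) * \<bar>u\<bar>\<close>. The constant may
      depend on \<open>\<epsilon>\<close>, since only integrability for fixed
      \<open>\<epsilon>\<close> is at stake.\<close>
    have E_bound: "\<bar>?E u\<bar> \<le> (C' * (1 + 1 / \<epsilon>)) / (1 + \<bar>u\<bar>)" for u
    proof (cases "\<epsilon> < \<bar>u\<bar>")
      case True
      then have "1 + \<bar>u\<bar> \<le> (1 + 1 / \<epsilon>) * \<bar>u\<bar>"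
        using \<epsilon> by (simp add: distrib_right)
      then have "1 / \<bar>u\<bar> \<le> (1 + 1 / \<epsilon>) / (1 + \<bar>u\<bar>)"
        using True \<epsilon> by (simp add: pos_divide_le_eq pos_le_divide_eq mult.commute)
      from mult_left_mono[OF this C'] show ?thesis using True E(2)[of u] by simp
    next
      case False
      then show ?thesis using C' \<epsilon> by simp
    qed
    have E_meas: "?E \<in> borel_measurable borel"
      using E(1) by measurable
    have int_g: "integrable lebesgue ?g"
      by (rule integrable_decay_convolution[OF fm f E_meas E_bound])
    have sets: "{t. \<epsilon> < \<bar>x - t\<bar>} \<in> sets lebesgue"
      by (rule sets_completionI_sets) (auto intro!: borel_open open_Collect_less continuous_intros)
    have int_F': "integrable lebesgue (\<lambda>t. indicator {t. \<epsilon> < \<bar>x - t\<bar>} t *\<^sub>R ?F t)"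
      using int_F sets integrable_mult_indicator by blast
    have "indicator {t. \<bar>x - t\<bar> > \<epsilon>} t *\<^sub>R (f t / of_real (x - t)) =
        indicator {t. \<epsilon> < \<bar>x - t\<bar>} t *\<^sub>R ?F t + ?g t" for t
    proof -
      have "f t / of_real (x - t) = (1 / (x - t)) *\<^sub>R f t"
        by (simp add: scaleR_conv_of_real)
      also have "\<dots> = ?F t + E (x - t) *\<^sub>R f t"
        by (simp add: KE scaleR_left_distrib)
      finally show ?thesis
        by (auto simp: indicator_def)
    qed
    then have T: "truncated_hilbert f x \<epsilon> = (1 / pi) *\<^sub>R ((\<integral>t. indicator {t. \<epsilon> < \<bar>x - t\<bar>} t *\<^sub>R ?F t \<partial>lebesgue)
        + (\<integral>t. ?g t \<partial>lebesgue))"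
      using int_F' int_g
      by (simp add: truncated_hilbert_def set_lebesgue_integral_def scaleR_conv_of_real)
    \<comment> \<open>The same integral is written twice, with \<open>t = x - u\<close> and with
      \<open>t = x + u\<close>; the factor 1/2 of the near part comes from averaging the
      two.\<close>
    have refl: "(\<integral>t. ?g t \<partial>lebesgue) = (\<integral>u. ?g (x + (-1) * u) \<partial>lebesgue)"
      "(\<integral>t. ?g t \<partial>lebesgue) = (\<integral>u. ?g (x + 1 * u) \<partial>lebesgue)"
      using lebesgue_integral_real_affine[of "-1" ?g x] lebesgue_integral_real_affine[of 1 ?g x] by simp_all
    have refl_int: "integrable lebesgue (\<lambda>u. ?g (x + (-1) * u))" "integrable lebesgue (\<lambda>u. ?g (x + 1 * u))"
      by (rule integrable_lebesgue_affine[OF int_g], simp)+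
    have "2 *\<^sub>R (\<integral>t. ?g t \<partial>lebesgue) = (\<integral>u. ?g (x + (-1) * u) \<partial>lebesgue) + (\<integral>u. ?g (x + 1 * u) \<partial>lebesgue)"
      unfolding refl[symmetric] by (simp add: scaleR_2)
    also have "\<dots> = (\<integral>u. ?g (x + (-1) * u) + ?g (x + 1 * u) \<partial>lebesgue)"
      using refl_int by (rule Bochner_Integration.integral_add[symmetric])
    also have "\<dots> = (\<integral>u. indicator {u. \<epsilon> < \<bar>0 - u\<bar>} u *\<^sub>R ?N u \<partial>lebesgue)"
      by (rule Bochner_Integration.integral_cong)
        (auto simp: E(3) indicator_def scaleR_diff_right)
    finally have "(\<integral>t. ?g t \<partial>lebesgue) = (1 / 2) *\<^sub>R (\<integral>u. indicator {u. \<epsilon> < \<bar>0 - u\<bar>} u *\<^sub>R ?N u \<partial>lebesgue)"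
      by (metis (no_types, lifting) divide_self_if mult.commute scaleR_one scaleR_scaleR times_divide_eq_right mult_1 zero_neq_numeral)
    then show ?thesis by (simp add: T)
  qed
  have "((\<lambda>\<epsilon>. (1 / pi) *\<^sub>R ((\<integral>t. indicator {t. \<epsilon> < \<bar>x - t\<bar>} t *\<^sub>R ?F t \<partial>lebesgue) +
      (1 / 2) *\<^sub>R (\<integral>u. indicator {u. \<epsilon> < \<bar>0 - u\<bar>} u *\<^sub>R ?N u \<partial>lebesgue))) \<longlongrightarrow>
      (1 / pi) *\<^sub>R ((\<integral>t. ?F t \<partial>lebesgue) + (1 / 2) *\<^sub>R (\<integral>u. ?N u \<partial>lebesgue))) (at_right 0)"
    by (intro tendsto_intros integral_delete_shrinking_interval int_F near) (auto simp: E0 K0)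
  then show ?thesis
    by (rule Lim_transform_eventually) (use trunc in \<open>auto simp: eventually_at_right_less eventually_at_filter\<close>)
qed

section \<open>The near part of the Hilbert transform\<close>

text \<open>With \<open>X = \<bar>x - y\<bar>\<close> and \<open>Y = 2 * \<bar>u\<bar>\<close>,
  grouping the four terms by the sign of the shift gives \<open>2 * H * X powr \<alpha>\<close>, and
  grouping them by base point gives \<open>2 * H * Y powr \<alpha>\<close>. The smaller of
  \<open>X powr \<alpha>\<close> and \<open>Y powr \<alpha>\<close> is at most
  \<open>X powr \<beta> * Y powr (\<alpha> - \<beta>)\<close>.\<close>

lemma norm_symmetric_difference_holder:
  fixes g :: "real \<Rightarrow> 'a::real_normed_vector"
  assumes "0 < \<beta>" "\<beta> < \<alpha>"
    and H: "\<And>y z. y \<in> T \<Longrightarrow> z \<in> T \<Longrightarrow> norm (g y - g z) \<le> H * \<bar>y - z\<bar> powr \<alpha>"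
    and T: "x - u \<in> T" "x + u \<in> T" "y - u \<in> T" "y + u \<in> T" and "x \<noteq> y"
  shows "norm ((g (x - u) - g (x + u)) - (g (y - u) - g (y + u)))
    \<le> 2 * H * (\<bar>x - y\<bar> powr \<beta> * (2 * \<bar>u\<bar>) powr (\<alpha> - \<beta>))"
proof -
  let ?X = "\<bar>x - y\<bar>" and ?Y = "2 * \<bar>u\<bar>"
  let ?d = "norm ((g (x - u) - g (x + u)) - (g (y - u) - g (y + u)))"
  have H0: "0 \<le> H"
    using norm_ge_zero[THEN order_trans, OF H[OF T(1,3)]] assms(8) by (simp add: zero_le_mult_iff)
  have "?d \<le> norm (g (x - u) - g (y - u)) + norm (g (x + u) - g (y + u))"
    using norm_triangle_ineq4[of "g (x - u) - g (y - u)" "g (x + u) - g (y + u)"]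
    by (simp add: algebra_simps)
  then have dX: "?d \<le> 2 * H * ?X powr \<alpha>"
    using H[OF T(1,3)] H[OF T(2,4)] by simp
  have "?d \<le> norm (g (x - u) - g (x + u)) + norm (g (y - u) - g (y + u))"
    by (rule norm_triangle_ineq4)
  then have dY: "?d \<le> 2 * H * ?Y powr \<alpha>"
    using H[OF T(1,2)] H[OF T(3,4)] by (simp add: abs_mult)
  show ?thesis
  proof (cases "?X \<le> ?Y")
    case True
    have "?X powr \<alpha> = ?X powr \<beta> * ?X powr (\<alpha> - \<beta>)"
      by (simp flip: powr_add)
    also have "\<dots> \<le> ?X powr \<beta> * ?Y powr (\<alpha> - \<beta>)"
      using True assms by (intro mult_left_mono powr_mono2) auto
    finally show ?thesis
      using dX H0 by (meson mult_left_mono order_trans mult_nonneg_nonneg zero_le_numeral)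
  next
    case False
    have "?Y powr \<alpha> = ?Y powr \<beta> * ?Y powr (\<alpha> - \<beta>)"
      by (simp flip: powr_add)
    also have "\<dots> \<le> ?X powr \<beta> * ?Y powr (\<alpha> - \<beta>)"
      using False assms by (intro mult_right_mono powr_mono2) auto
    finally show ?thesis
      using dY H0 by (meson mult_left_mono order_trans mult_nonneg_nonneg zero_le_numeral)
  qed
qed

text \<open>The integrand vanishes for \<open>\<bar>u\<bar> \<ge> \<delta>\<close> and is
  \<open>O(\<bar>u\<bar> powr (\<alpha> - 1))\<close> inside, integrable since \<alpha> is positive.
  Doubling the interval keeps \<open>x - u\<close> and \<open>x + u\<close> in the domain of the
  Hoelder bound.\<close>

lemma integrable_symmetric_difference:
  fixes g :: "real \<Rightarrow> 'a::euclidean_space"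
  assumes "0 < \<alpha>"
    and hol: "holder_continuous_on \<alpha> {x0 - 2 * \<delta><..<x0 + 2 * \<delta>} g"
    and E: "E \<in> borel_measurable borel" "\<And>u. \<bar>E u\<bar> \<le> C / \<bar>u\<bar>" "\<And>u. \<delta> \<le> \<bar>u\<bar> \<Longrightarrow> E u = 0"
    and x: "x \<in> {x0 - \<delta><..<x0 + \<delta>}"
  shows "integrable lebesgue (\<lambda>u. E u *\<^sub>R (g (x - u) - g (x + u)))"
proof -
  let ?T = "{x0 - 2 * \<delta><..<x0 + 2 * \<delta>}"
  obtain H where H: "\<And>y z. y \<in> ?T \<Longrightarrow> z \<in> ?T \<Longrightarrow> norm (g y - g z) \<le> H * \<bar>y - z\<bar> powr \<alpha>"
    using hol unfolding holder_continuous_on_def by blast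
  have cont: "continuous_on ?T g"
    by (rule holder_continuous_on_imp_continuous_on[OF hol assms(1)])
  let ?w = "\<lambda>u. C * \<bar>H\<bar> * 2 powr \<alpha> * (indicator {-\<delta><..<\<delta>} u * \<bar>u\<bar> powr (\<alpha> - 1))"
  have C0: "0 \<le> C" using E(2)[of 1] by simp
  \<comment> \<open>Information on \<open>g\<close> is available only on \<open>?T\<close>. The
    indicator confines the arguments to it, so measurability follows from continuity there;
    multiplying by \<open>E\<close> makes the indicator invisible.\<close>
  have "(\<lambda>u. E u *\<^sub>R (indicator {-\<delta><..<\<delta>} u *\<^sub>R (g (x - u) - g (x + u)))) \<in> borel_measurable borel"
    using x by (intro borel_measurable_scaleR[OF E(1)] borel_measurable_continuous_on_indicator
        continuous_intros continuous_on_compose2[OF cont]) auto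
  moreover have "E u *\<^sub>R (indicator {-\<delta><..<\<delta>} u *\<^sub>R (g (x - u) - g (x + u))) = E u *\<^sub>R (g (x - u) - g (x + u))" for u
    using E(3)[of u] by (cases "\<delta> \<le> \<bar>u\<bar>") (auto simp: indicator_def)
  ultimately have "(\<lambda>u. E u *\<^sub>R (g (x - u) - g (x + u))) \<in> borel_measurable borel"
    by (simp only:)
  then have meas: "(\<lambda>u. E u *\<^sub>R (g (x - u) - g (x + u))) \<in> borel_measurable lebesgue"
    by (rule borel_measurable_lebesgueI)
  have w: "integrable lebesgue ?w"
    using integrable_abs_powr_near_0[of "\<alpha> - 1" \<delta>] assms(1) by (intro integrable_mult_right) auto
  have "norm (E u *\<^sub>R (g (x - u) - g (x + u))) \<le> ?w u" for u
  proof (cases "\<bar>u\<bar> < \<delta> \<and> u \<noteq> 0")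
    case True
    then have "x - u \<in> ?T" "x + u \<in> ?T" using x by (auto simp: abs_less_iff)
    from H[OF this] have "norm (g (x - u) - g (x + u)) \<le> H * (2 * \<bar>u\<bar>) powr \<alpha>"
      by (simp add: abs_mult)
    also have "\<dots> \<le> \<bar>H\<bar> * (2 * \<bar>u\<bar>) powr \<alpha>" by (intro mult_right_mono) auto
    finally have "\<bar>E u\<bar> * norm (g (x - u) - g (x + u)) \<le> (C / \<bar>u\<bar>) * (\<bar>H\<bar> * (2 * \<bar>u\<bar>) powr \<alpha>)"
      using E(2) C0 by (intro mult_mono) auto
    also have "\<dots> = ?w u"
      using True by (auto simp: powr_mult powr_diff indicator_def abs_less_iff)
    finally show ?thesis by simp
  next
    case False
    then show ?thesis using E(3)[of u] C0 by auto
  qed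
  then show ?thesis
    using Bochner_Integration.integrable_bound[OF w meas] by (smt (verit) AE_I2 real_norm_def)
qed

text \<open>The interpolated bound leaves \<open>\<bar>u\<bar> powr (\<alpha> - \<beta>)\<close>,
  and the kernel costs one power of \<open>\<bar>u\<bar>\<close>. The resulting weight
  \<open>\<bar>u\<bar> powr (\<alpha> - \<beta> - 1)\<close> is integrable near 0 and provides the
  modulus at every order.\<close>

lemma derivative_chain_symmetric_difference:
  fixes D :: "nat \<Rightarrow> real \<Rightarrow> 'a::euclidean_space"
  assumes \<beta>: "0 < \<beta>" "\<beta> < \<alpha>"
    and hol: "\<And>j. j \<le> k \<Longrightarrow> holder_continuous_on \<alpha> {x0 - 2 * \<delta><..<x0 + 2 * \<delta>} (D j)"
    and der: "\<And>j x. j < k \<Longrightarrow> x \<in> {x0 - 2 * \<delta><..<x0 + 2 * \<delta>} \<Longrightarrow>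
      (D j has_vector_derivative D (Suc j) x) (at x)"
    and E: "E \<in> borel_measurable borel" "\<And>u. \<bar>E u\<bar> \<le> C / \<bar>u\<bar>" "\<And>u. \<delta> \<le> \<bar>u\<bar> \<Longrightarrow> E u = 0"
  shows "derivative_chain k \<beta> {x0 - \<delta><..<x0 + \<delta>}
    (\<lambda>j x. \<integral>u. E u *\<^sub>R (D j (x - u) - D j (x + u)) \<partial>lebesgue)"
proof -
  let ?T = "{x0 - 2 * \<delta><..<x0 + 2 * \<delta>}" and ?S = "{x0 - \<delta><..<x0 + \<delta>}"
  have "\<exists>H. \<forall>j\<le>k. \<forall>y\<in>?T. \<forall>z\<in>?T. norm (D j y - D j z) \<le> H j * \<bar>y - z\<bar> powr \<alpha>"
    using hol unfolding holder_continuous_on_def by metis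
  then obtain H where H: "\<And>j y z. j \<le> k \<Longrightarrow> y \<in> ?T \<Longrightarrow> z \<in> ?T \<Longrightarrow>
      norm (D j y - D j z) \<le> H j * \<bar>y - z\<bar> powr \<alpha>"
    by metis
  have H': "norm (D j y - D j z) \<le> \<bar>H j\<bar> * \<bar>y - z\<bar> powr \<alpha>" if "j \<le> k" "y \<in> ?T" "z \<in> ?T" for j y z
    using H[OF that] mult_right_mono[OF abs_ge_self[of "H j"] powr_ge_zero[of "\<bar>y - z\<bar>" \<alpha>]] by linarith
  have C0: "0 \<le> C" using E(2)[of 1] by simp
  let ?w = "\<lambda>j u. C * (2 * \<bar>H j\<bar> * 2 powr (\<alpha> - \<beta>)) *
    (indicator {-\<delta><..<\<delta>} u * \<bar>u\<bar> powr (\<alpha> - \<beta> - 1))"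
  show ?thesis
  proof (rule derivative_chain_integral[where w = ?w])
    show "integrable lebesgue (\<lambda>u. E u *\<^sub>R (D j (x - u) - D j (x + u)))"
      if "j \<le> k" "x \<in> ?S" for j x
      by (rule integrable_symmetric_difference[OF _ hol E]) (use that \<beta> in auto)
    show "integrable lebesgue (?w j)" for j
      using integrable_abs_powr_near_0[of "\<alpha> - \<beta> - 1" \<delta>] \<beta> by (intro integrable_mult_right) auto
    show "((\<lambda>x. E u *\<^sub>R (D j (x - u) - D j (x + u))) has_vector_derivative
        E u *\<^sub>R (D (Suc j) (x - u) - D (Suc j) (x + u))) (at x)"
      if "j < k" "x \<in> ?S" for j x u
    proof (cases "\<bar>u\<bar> < \<delta>")
      case True
      have shift: "((\<lambda>x. D j (x + c)) has_vector_derivative D (Suc j) (x + c)) (at x)"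
        if c: "x + c \<in> ?T" for c
      proof -
        have "((\<lambda>x. x + c) has_vector_derivative 1) (at x)"
          by (auto intro!: derivative_eq_intros)
        from vector_diff_chain_at[OF this der[OF \<open>j < k\<close> c]] show ?thesis by (simp add: o_def)
      qed
      have "((\<lambda>x. D j (x - u) - D j (x + u)) has_vector_derivative
          D (Suc j) (x - u) - D (Suc j) (x + u)) (at x)"
      proof (rule has_vector_derivative_diff)
        have "x + - u \<in> ?T" "x + u \<in> ?T" using True that(2) by (auto simp: abs_less_iff)
        then show "((\<lambda>x. D j (x - u)) has_vector_derivative D (Suc j) (x - u)) (at x)"
          "((\<lambda>x. D j (x + u)) has_vector_derivative D (Suc j) (x + u)) (at x)"
          using shift[of "-u"] shift[of u] by simp_all
      qed
      from has_vector_derivative_scaleR[OF DERIV_const[of "E u"] this] show ?thesis by simp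
    next
      case False
      then show ?thesis using E(3)[of u] by simp
    qed
    show "norm (E u *\<^sub>R (D j (x - u) - D j (x + u)) - E u *\<^sub>R (D j (y - u) - D j (y + u)))
        \<le> \<bar>x - y\<bar> powr \<beta> * ?w j u"
      if "j \<le> k" "x \<in> ?S" "y \<in> ?S" for j x y u
    proof (cases "\<bar>u\<bar> < \<delta> \<and> u \<noteq> 0 \<and> x \<noteq> y")
      case True
      have "norm ((D j (x - u) - D j (x + u)) - (D j (y - u) - D j (y + u)))
          \<le> 2 * \<bar>H j\<bar> * (\<bar>x - y\<bar> powr \<beta> * (2 * \<bar>u\<bar>) powr (\<alpha> - \<beta>))"
        by (rule norm_symmetric_difference_holder[where T = ?T]) (use H' that True \<beta> in auto)
      then have "\<bar>E u\<bar> * norm ((D j (x - u) - D j (x + u)) - (D j (y - u) - D j (y + u)))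
          \<le> (C / \<bar>u\<bar>) * (2 * \<bar>H j\<bar> * (\<bar>x - y\<bar> powr \<beta> * (2 * \<bar>u\<bar>) powr (\<alpha> - \<beta>)))"
        using E(2) C0 by (intro mult_mono) auto
      also have "\<dots> = \<bar>x - y\<bar> powr \<beta> * ?w j u"
      proof -
        have "indicator {-\<delta><..<\<delta>} u = (1::real)" using True by (auto simp: abs_less_iff)
        then show ?thesis by (simp add: powr_mult powr_diff mult_ac)
      qed
      finally show ?thesis by (simp flip: scaleR_diff_right)
    next
      case False
      then have "E u = 0 \<or> u = 0 \<or> x = y" using E(3)[of u] by auto
      then show ?thesis using C0 by auto
    qed
  qed (use \<beta> in auto)
qed

text \<open>Supplies the Hoelder bound at orders below \<open>k\<close>. There the next derivative
  is continuous on the compact interval \<open>{c..d}\<close> inside \<open>{a<..<b}\<close>, hence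
  bounded, which makes the present one Lipschitz; length at most 1 turns this into exponent
  \<alpha>.\<close>

lemma Ck_holder_on_imp_lower_holder:
  assumes f: "Ck_holder_on k \<alpha> {a<..<b} f" and "0 < \<alpha>" "\<alpha> \<le> 1"
    and sub: "a < c" "d < b" "d \<le> c + 1" and j: "j \<le> k"
  shows "holder_continuous_on \<alpha> {c<..<d} (nth_derivative j f)"
proof (cases "j = k")
  case True
  then show ?thesis
    using f sub unfolding Ck_holder_on_def holder_continuous_on_def
    by (meson greaterThanLessThan_iff less_trans)
next
  case False
  with j have jk: "j < k" by simp
  let ?D = "nth_derivative j f" and ?D' = "nth_derivative (Suc j) f"
  have der: "(?D has_vector_derivative ?D' x) (at x)" if "x \<in> {a<..<b}" for x
    using f jk that vector_derivative_works[of ?D "at x"]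
    by (auto simp: Ck_holder_on_def k_times_cont_diff_on_def nth_derivative_def)
  have "continuous_on {a<..<b} ?D'"
    using f jk unfolding Ck_holder_on_def k_times_cont_diff_on_def by (meson Suc_leI)
  then have "continuous_on {c..d} ?D'"
    by (rule continuous_on_subset) (use sub in auto)
  then have "bounded (?D' ` {c..d})"
    by (intro compact_imp_bounded compact_continuous_image) auto
  then obtain B where B: "\<And>x. x \<in> {c..d} \<Longrightarrow> norm (?D' x) \<le> B"
    unfolding bounded_iff by blast
  have "norm (?D x - ?D y) \<le> B * \<bar>x - y\<bar> powr \<alpha>" if xy: "x \<in> {c<..<d}" "y \<in> {c<..<d}" for x y
  proof -
    have B0: "0 \<le> B" using order_trans[OF norm_ge_zero B[of x]] xy by simp
    have "norm (?D x - ?D y) \<le> B * norm (x - y)"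
    proof (rule differentiable_bound[where S = "{c<..<d}"])
      fix z assume z: "z \<in> {c<..<d}"
      then show "(?D has_derivative (\<lambda>h. h *\<^sub>R ?D' z)) (at z within {c<..<d})"
        using der[of z] sub unfolding has_vector_derivative_def
        by (auto intro: has_derivative_at_withinI)
      show "onorm (\<lambda>h. h *\<^sub>R ?D' z) \<le> B"
      proof (rule onorm_le)
        show "norm (h *\<^sub>R ?D' z) \<le> B * norm h" for h
          using mult_right_mono[OF B[of z], of "norm h"] z by (simp add: mult.commute)
      qed
    qed (use xy in auto)
    also have "norm (x - y) \<le> \<bar>x - y\<bar> powr \<alpha>"
      using powr_mono'[of \<alpha> 1 "\<bar>x - y\<bar>"] assms(2,3) sub xy by auto
    then have "B * norm (x - y) \<le> B * \<bar>x - y\<bar> powr \<alpha>"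
      using B0 by (rule mult_left_mono)
    finally show ?thesis .
  qed
  then show ?thesis unfolding holder_continuous_on_def by blast
qed

section \<open>Local regularity of the Hilbert transform from its far and near parts\<close>

theorem theorem1p1:
  fixes f :: "real \<Rightarrow> 'a::{real_normed_field,euclidean_space}"
    and p \<alpha> x0 :: real and k :: nat
  assumes "1 \<le> p"
    and "in_Lp p f"
    and "0 < \<alpha>" and "\<alpha> < 1"
    and "Ck_holder_near k \<alpha> x0 f"
  shows "\<forall>\<alpha>0. 0 < \<alpha>0 \<and> \<alpha>0 < \<alpha> \<longrightarrow>
           (\<forall>\<^sub>F x in nhds x0. hilbert_exists_at f x) \<and>
           Ck_holder_near k \<alpha>0 x0 (hilbert_transform f)"
proof (intro allI impI)
  fix \<beta> assume \<beta>: "0 < \<beta> \<and> \<beta> < \<alpha>"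
  have fm: "f \<in> borel_measurable lebesgue" using assms(2) by (simp add: in_Lp_def)
  have fw: "integrable lebesgue (\<lambda>t. norm (f t) / (1 + \<bar>t\<bar>))"
    by (rule in_Lp_imp_integrable_weighted[OF assms(1,2)])
  obtain a b where ab: "a < x0" "x0 < b" "Ck_holder_on k \<alpha> {a<..<b} f"
    using assms(5) by (auto simp: Ck_holder_near_def)
  \<comment> \<open>The thirds place the closed interval of radius \<open>2 * \<delta>\<close>
    strictly inside \<open>{a<..<b}\<close>. The bound 1/4 gives that interval length at most
    1.\<close>
  define \<delta> where "\<delta> = min (min ((x0 - a) / 3) ((b - x0) / 3)) (1 / 4)"
  have \<delta>: "0 < \<delta>" "\<delta> \<le> 1 / 4" "3 * \<delta> \<le> x0 - a" "3 * \<delta> \<le> b - x0"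
    using ab by (auto simp: \<delta>_def min_def)
  let ?T = "{x0 - 2 * \<delta><..<x0 + 2 * \<delta>}" and ?S = "{x0 - \<delta><..<x0 + \<delta>}"
  let ?D = "\<lambda>j. nth_derivative j f"
  have hol: "holder_continuous_on \<alpha> ?T (?D j)" if "j \<le> k" for j
    by (rule Ck_holder_on_imp_lower_holder[OF ab(3)]) (use assms \<delta> that in auto)
  have der: "(?D j has_vector_derivative ?D (Suc j) x) (at x)" if "j < k" "x \<in> ?T" for j x
    using ab(3) \<delta> that vector_derivative_works[of "?D j" "at x"]
    by (auto simp: Ck_holder_on_def k_times_cont_diff_on_def nth_derivative_def)
  obtain \<kappa> where \<kappa>: "decaying_kernel (Suc k) \<kappa>" "\<And>u. \<kappa> 0 (- u) = - \<kappa> 0 u"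
    "\<And>u. \<delta> \<le> \<bar>u\<bar> \<Longrightarrow> \<kappa> 0 u = 1 / u"
    using smooth_truncation_of_Hilbert_kernel[of \<delta> "Suc k"] \<delta> by auto
  have \<kappa>_meas: "\<kappa> 0 \<in> borel_measurable borel"
    using \<kappa>(1) by (intro borel_measurable_continuous_onI) (simp add: decaying_kernel_def)
  obtain C where C: "\<And>u. \<bar>\<kappa> 0 u\<bar> \<le> C / (1 + \<bar>u\<bar>)"
    using \<kappa>(1) unfolding decaying_kernel_def by blast
  have C0: "0 \<le> C" using C[of 0] by simp
  define E where "E u = 1 / u - \<kappa> 0 u" for u
  have E_meas: "E \<in> borel_measurable borel"
    unfolding E_def[abs_def] using \<kappa>_meas by measurable
  have E_odd: "E (- u) = - E u" for u by (simp add: E_def \<kappa>(2))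
  have E_far: "E u = 0" if "\<delta> \<le> \<bar>u\<bar>" for u using \<kappa>(3)[OF that] by (simp add: E_def)
  \<comment> \<open>The summand 1 is the share of \<open>1 / u\<close> and \<open>C\<close> that of
    the smooth kernel; at 0 oddness forces the value 0.\<close>
  have E_bound: "\<bar>E u\<bar> \<le> (1 + C) / \<bar>u\<bar>" for u
  proof (cases "u = 0")
    case True
    then show ?thesis using E_odd[of 0] by simp
  next
    case False
    have "C / (1 + \<bar>u\<bar>) \<le> C / \<bar>u\<bar>" using C0 False by (intro divide_left_mono) auto
    with C[of u] have "\<bar>\<kappa> 0 u\<bar> \<le> C / \<bar>u\<bar>" by linarith
    then show ?thesis
      using abs_triangle_ineq4[of "1 / u" "\<kappa> 0 u"] by (simp add: E_def add_divide_distrib)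
  qed
  let ?far = "\<lambda>j x. \<integral>t. \<kappa> j (x - t) *\<^sub>R f t \<partial>lebesgue"
  let ?near = "\<lambda>j x. \<integral>u. E u *\<^sub>R (?D j (x - u) - ?D j (x + u)) \<partial>lebesgue"
  let ?\<Phi> = "\<lambda>j x. (1 / pi) *\<^sub>R (?far j x + (1 / 2) *\<^sub>R ?near j x)"
  have "derivative_chain k \<beta> ?S ?far"
    by (rule derivative_chain_decay_convolution[OF fm fw \<kappa>(1)]) (use \<beta> assms \<delta> in auto)
  moreover have "derivative_chain k \<beta> ?S ?near"
    using \<beta>
    by (intro derivative_chain_symmetric_difference[where D = ?D, OF _ _ hol der E_meas E_bound E_far]) auto
  ultimately have chain: "derivative_chain k \<beta> ?S ?\<Phi>"
    by (intro derivative_chain_scaleR derivative_chain_add)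
  have D0: "?D 0 = f" by (simp add: nth_derivative_def)
  \<comment> \<open>The limit exists at every point of \<open>?S\<close>, not merely almost
    everywhere, so \<open>hilbert_transform f\<close> coincides with \<open>?\<Phi> 0\<close>
    throughout \<open>?S\<close> and inherits its derivatives.\<close>
  have lim: "(truncated_hilbert f x \<longlongrightarrow> ?\<Phi> 0 x) (at_right 0)" if x: "x \<in> ?S" for x
    unfolding D0
  proof (rule truncated_hilbert_tendsto[OF fm fw \<kappa>_meas C E_meas E_bound E_odd])
    show "integrable lebesgue (\<lambda>u. E u *\<^sub>R (f (x - u) - f (x + u)))"
      by (rule integrable_symmetric_difference[OF assms(3) _ E_meas E_bound E_far x])
        (use hol[of 0] D0 in simp)
  qed (simp add: E_def)
  have "Ck_holder_on k \<beta> ?S (hilbert_transform f)"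
  proof (rule derivative_chain_imp_Ck_holder_on[OF chain])
    show "hilbert_transform f x = ?\<Phi> 0 x" if "x \<in> ?S" for x
      unfolding hilbert_transform_def using lim[OF that] by (intro tendsto_Lim) simp
  qed (use \<beta> in auto)
  moreover have "\<forall>\<^sub>F x in nhds x0. x \<in> ?S"
    using \<delta> by (intro eventually_nhds_in_open) auto
  then have "\<forall>\<^sub>F x in nhds x0. hilbert_exists_at f x"
    by (rule eventually_mono) (use lim in \<open>auto simp: hilbert_exists_at_def\<close>)
  ultimately show "(\<forall>\<^sub>F x in nhds x0. hilbert_exists_at f x) \<and>
      Ck_holder_near k \<beta> x0 (hilbert_transform f)"
    unfolding Ck_holder_near_def using \<delta> by (intro conjI exI[of _ "x0 - \<delta>"] exI[of _ "x0 + \<delta>"]) auto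
qed

end
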